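(* Let $\Delta\subset\mathbb{R}^n$ be a compact $n$-dimensional Delzant polytope, written as $\Delta=\{x\in\mathbb{R}^n:\ \ell_i(x)\ge 0,\ i=1,\dots,d\}$, where $d$ is the number of facets and $\ell_i(x)=c_i-\langle u_i,x\rangle$ is the lattice distance to the $i$-th facet. For $x,y\in\Delta$ and $N\in\mathbb{Z}_{+}$ put $$E_N(x,y)=\prod_{i=1}^d \ell_i(y)^{N\ell_i(x)}e^{-N\ell_i(y)}\quad(\text{i.e. } E_N=\exp(N\varphi(x,y)),\ \varphi(x,y)=\textstyle\sum_{i}\ell_i(x)\log\ell_i(y)-\ell_i(y)),$$ with the convention $0^0=1$, let $c_N(x)=\int_\Delta E_N(x,y)\,dy$ ($dy$ Lebesgue measure) and $K_N(x,y)=c_N(x)^{-1}E_N(x,y)$. Then there exist differential operators $P_i(x,D):C^\infty(\Delta)\to C^\infty(\Delta)$, $i=0,1,2,\dots$, with $P_i$ of order $2i$ and $P_0=I$, such that for every $f\in C^\infty(\Delta)$ $$\int_\Delta K_N(x,y)f(y)\,dy\ \sim\ \sum_{i=0}^\infty \big(P_i(x,D)f\big)(x)\,N^{-i}\qquad (N\to\infty),$$ i.e. for every $x\in\Delta$ and every $m\ge1$, $\int_\Delta K_N(x,y)f(y)\,dy-\sum_{i=0}^{m-1}(P_i(x,D)f)(x)N^{-i}=O(N^{-m})$.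
   Context: A Delzant polytope is a compact convex polytope $\Delta=\{x:\langle u_i,x\rangle\le c_i,\ i=1,\dots,d\}$ in $\mathbb{R}^n$ where each $u_i\in(\mathbb{Z}^n)^*$ is a primitive lattice vector, outward normal to the $i$-th facet, each $c_i$ is an integer, each vertex lies on exactly $n$ facets, and the normals $u_i$ of the facets through any vertex form a $\mathbb{Z}$-basis of the lattice. (Equivalently, $\Delta$ is the moment polytope of a compact non-singular toric manifold.) The function $\ell_i$ is called the lattice distance to the $i$-th facet. *)

theory Defs
  imports "HOL-Analysis.Analysis" "HOL-Library.Landau_Symbols"
begin

definition dpart :: "'n::finite \<Rightarrow> (real^'n \<Rightarrow> real) \<Rightarrow> real^'n \<Rightarrow> real" where
  "dpart j f x = frechet_derivative f (at x) (axis j 1)"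

fun iter_part :: "'n::finite list \<Rightarrow> (real^'n \<Rightarrow> real) \<Rightarrow> real^'n \<Rightarrow> real" where
  "iter_part [] f = f"
| "iter_part (j # js) f = dpart j (iter_part js f)"

definition smooth_on_open :: "(real^'n::finite) set \<Rightarrow> (real^'n \<Rightarrow> real) \<Rightarrow> bool" where
  "smooth_on_open U f \<longleftrightarrow> open U \<and> (\<forall>js x. x \<in> U \<longrightarrow> iter_part js f differentiable (at x))"

definition smooth_on_set :: "(real^'n::finite) set \<Rightarrow> (real^'n \<Rightarrow> real) \<Rightarrow> bool" where
  "smooth_on_set S f \<longleftrightarrow> (\<exists>U g. S \<subseteq> U \<and> smooth_on_open U g \<and> (\<forall>x\<in>S. g x = f x))"

definition dop :: "nat \<Rightarrow> ('n::finite list \<Rightarrow> real^'n \<Rightarrow> real) \<Rightarrow> (real^'n \<Rightarrow> real) \<Rightarrow> real^'n \<Rightarrow> real" where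
  "dop k a g x = (\<Sum>js\<in>{js. length js \<le> k}. a js x * iter_part js g x)"

definition psym :: "nat \<Rightarrow> ('n::finite list \<Rightarrow> real^'n \<Rightarrow> real) \<Rightarrow> real^'n \<Rightarrow> real^'n \<Rightarrow> real" where
  "psym k a x \<xi> = (\<Sum>js\<in>{js. length js = k}. a js x * prod_list (map (\<lambda>j. \<xi> $ j) js))"

definition lat_dist :: "(nat \<Rightarrow> int^'n::finite) \<Rightarrow> (nat \<Rightarrow> int) \<Rightarrow> nat \<Rightarrow> real^'n \<Rightarrow> real" where
  "lat_dist u c i x = of_int (c i) - (\<Sum>j\<in>UNIV. of_int (u i $ j) * x $ j)"

definition poly_set :: "nat \<Rightarrow> (nat \<Rightarrow> int^'n::finite) \<Rightarrow> (nat \<Rightarrow> int) \<Rightarrow> (real^'n) set" where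
  "poly_set d u c = {x. \<forall>i<d. lat_dist u c i x \<ge> 0}"

definition primitive_vec :: "int^'n::finite \<Rightarrow> bool" where
  "primitive_vec v \<longleftrightarrow> (\<forall>(k::int) (w::int^'n). (\<forall>j. v $ j = k * w $ j) \<longrightarrow> k = 1 \<or> k = -1)"

definition zbasis :: "(int^'n::finite) set \<Rightarrow> bool" where
  "zbasis B \<longleftrightarrow> finite B \<and>
     (\<forall>w::int^'n. \<exists>k::int^'n \<Rightarrow> int. \<forall>j. w $ j = (\<Sum>b\<in>B. k b * b $ j)) \<and>
     (\<forall>k::int^'n \<Rightarrow> int. (\<forall>j. (\<Sum>b\<in>B. k b * b $ j) = 0) \<longrightarrow> (\<forall>b\<in>B. k b = 0))"

text \<open>Delzant polytope {x. <u_i,x> <= c_i, i<d}, with the i-th inequality defining the i-th facet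
  (so d is the number of facets).\<close>
definition delzant :: "nat \<Rightarrow> (nat \<Rightarrow> int^'n::finite) \<Rightarrow> (nat \<Rightarrow> int) \<Rightarrow> bool" where
  "delzant d u c \<longleftrightarrow>
     compact (poly_set d u c) \<and> interior (poly_set d u c) \<noteq> {} \<and>
     (\<forall>i<d. primitive_vec (u i)) \<and> inj_on u {..<d} \<and>
     (\<forall>i<d. {x \<in> poly_set d u c. lat_dist u c i x = 0} facet_of poly_set d u c) \<and>
     (\<forall>v. v extreme_point_of poly_set d u c \<longrightarrow>
        card {i. i < d \<and> lat_dist u c i v = 0} = CARD('n) \<and>
        zbasis (u ` {i. i < d \<and> lat_dist u c i v = 0}))"

text \<open>Power with the convention 0^0 = 1 (base assumed nonnegative).\<close>
definition pw :: "real \<Rightarrow> real \<Rightarrow> real" where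
  "pw a b = (if b = 0 then 1 else a powr b)"

definition EN :: "nat \<Rightarrow> (nat \<Rightarrow> int^'n::finite) \<Rightarrow> (nat \<Rightarrow> int) \<Rightarrow> nat \<Rightarrow> real^'n \<Rightarrow> real^'n \<Rightarrow> real" where
  "EN d u c N x y = (\<Prod>i<d. pw (lat_dist u c i y) (real N * lat_dist u c i x)
                            * exp (- real N * lat_dist u c i y))"

definition cN :: "nat \<Rightarrow> (nat \<Rightarrow> int^'n::finite) \<Rightarrow> (nat \<Rightarrow> int) \<Rightarrow> nat \<Rightarrow> real^'n \<Rightarrow> real" where
  "cN d u c N x = (LINT y:poly_set d u c|lborel. EN d u c N x y)"

definition KN :: "nat \<Rightarrow> (nat \<Rightarrow> int^'n::finite) \<Rightarrow> (nat \<Rightarrow> int) \<Rightarrow> nat \<Rightarrow> real^'n \<Rightarrow> real^'n \<Rightarrow> real" where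
  "KN d u c N x y = EN d u c N x y / cN d u c N x"

end

theory Submission
  imports Defs "Jordan_Normal_Form.Determinant"
begin

text \<open>
  The gradient of \<open>\<phi>(x, \<cdot>)\<close> at \<open>y\<close> is \<open>- H(y) (y - x)\<close> with \<open>H = \<Sum>i. u\<^sub>i u\<^sub>i\<^sup>T / \<ell>\<^sub>i\<close>. The Delzant condition makes
  \<open>G = H\<^sup>-\<^sup>1\<close> extend smoothly to a neighbourhood of the polytope, with columns \<open>G\<^sub>j\<close> tangent to the facets.
  Integrating the divergence of \<open>E\<^sub>N f G\<^sub>j\<close> therefore yields the exact identity
  \<open>N \<langle>(y - x)\<^sub>j f\<rangle> = \<langle>div (f G\<^sub>j)\<rangle>\<close>, where \<open>\<langle>\<cdot>\<rangle>\<close> is integration against \<open>K\<^sub>N(x, \<cdot>)\<close>; it holds at boundary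
  points \<open>x\<close> just as in the interior. With Hadamard's lemma
  \<open>f(y) = f(x) + \<Sum>j. (y - x)\<^sub>j f\<^sub>j(y)\<close> this becomes \<open>\<langle>f\<rangle> = f(x) + \<langle>T\<^sub>x f\<rangle> / N\<close> with
  \<open>T\<^sub>x f = \<Sum>j. div (f\<^sub>j G\<^sub>j)\<close>. Iterating, \<open>P\<^sub>i f(x) = (T\<^sub>x\<^sup>i f)(x)\<close>, and the remainder is controlled by
  the supremum of \<open>T\<^sub>x\<^sup>m f\<close>. The principal symbol of \<open>P\<^sub>i\<close> is \<open>(\<xi>\<^sup>T G \<xi> / 2)\<^sup>i / i!\<close>.
\<close>

text \<open>Laplace's method would not treat all points alike: at interior \<open>x\<close> the
  weight is Gaussian in the limit, while normal to a facet through \<open>x\<close> it decays like a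
  plain exponential. An exact identity has no such case split. The gradient is linear in y - x
  because l_i(x) / l_i(y) - 1 = <u_i, y - x> / l_i(y), where the -1 comes from the factor exp(-N
  l_i(y)). Two obstacles remain. The Hessian H blows up on the facets, so G is taken from an
  enlarged linear system without division by l_i. And E_N extended by zero need not be
  differentiable; it even jumps across facets through \<open>x\<close>. Hence a damped weight is
  used, and tangency of the columns of G makes the damping error disappear in the limit. Finally,
  T_x depends on \<open>x\<close>, so T_x applied i times is not the i-th power of one differential
  operator. Taking the f_j as averages over segments from \<open>x\<close> makes their derivatives
  at \<open>x\<close> explicit multiples of those of f; this turns the value at \<open>x\<close>
  into a differential operator with coefficients built from G alone.\<close>

no_notation vec_index (infixl "$" 100)
no_notation scalar_prod (infix "\<bullet>" 70)

section \<open>Smooth functions\<close>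

lemma dpart_eq: "(f has_derivative D) (at x) \<Longrightarrow> dpart j f x = D (axis j 1)"
  unfolding dpart_def using frechet_derivative_at by metis

lemma has_derivative_dpart:
  assumes "f differentiable (at x)"
  shows "(f has_derivative (\<lambda>v. \<Sum>j\<in>UNIV. v $ j * dpart j f x)) (at x)"
proof -
  have D: "(f has_derivative frechet_derivative f (at x)) (at x)"
    using assms frechet_derivative_works by blast
  then interpret bounded_linear "frechet_derivative f (at x)" by (rule has_derivative_bounded_linear)
  have "frechet_derivative f (at x) v = (\<Sum>j\<in>UNIV. v $ j * dpart j f x)" for v
  proof -
    have "frechet_derivative f (at x) v = frechet_derivative f (at x) (\<Sum>j\<in>UNIV. v $ j *\<^sub>R axis j 1)"
      using basis_expansion[of v] by (simp add: scalar_mult_eq_scaleR)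
    then show ?thesis by (simp add: sum scaleR dpart_def)
  qed
  then show ?thesis using D by presburger
qed

lemma has_derivative_cong_open:
  assumes "open U" "x \<in> U" "\<And>y. y \<in> U \<Longrightarrow> f y = g y"
  shows "(f has_derivative D) (at x) \<longleftrightarrow> (g has_derivative D) (at x)"
  using has_derivative_transform_within_open[of f D x UNIV U g]
    has_derivative_transform_within_open[of g D x UNIV U f] assms by auto

lemma dpart_cong_open:
  assumes "open U" "x \<in> U" "\<And>y. y \<in> U \<Longrightarrow> f y = g y"
  shows "dpart j f x = dpart j g x"
  using has_derivative_cong_open[OF assms] unfolding dpart_def frechet_derivative_def by simp

lemma iter_part_append: "iter_part (js @ ks) f = iter_part js (iter_part ks f)"
  by (induction js) auto

lemma smooth_on_openD: "smooth_on_open U f \<Longrightarrow> x \<in> U \<Longrightarrow> f differentiable (at x)"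
  unfolding smooth_on_open_def by (metis iter_part.simps(1))

lemma smooth_on_open_iter_part: "smooth_on_open U f \<Longrightarrow> smooth_on_open U (iter_part ks f)"
  unfolding smooth_on_open_def iter_part_append[symmetric] by blast

lemma smooth_on_open_dpart: "smooth_on_open U f \<Longrightarrow> smooth_on_open U (dpart k f)"
  using smooth_on_open_iter_part[of U f "[k]"] by simp

lemma smooth_on_open_subset: "smooth_on_open U f \<Longrightarrow> open V \<Longrightarrow> V \<subseteq> U \<Longrightarrow> smooth_on_open V f"
  unfolding smooth_on_open_def by blast

lemma smooth_on_open_continuous_on: "smooth_on_open U f \<Longrightarrow> continuous_on U f"
  by (meson continuous_at_imp_continuous_on differentiable_imp_continuous_within smooth_on_openD)

text \<open>The induction over the list of directions carries membership in \<open>P\<close> up to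
  agreement on \<open>U\<close>. Agreement there is enough, because derivatives are local on an open
  set.\<close>

lemma smooth_on_open_coinduct:
  assumes "open U" "P f"
    and diff: "\<And>f x. P f \<Longrightarrow> x \<in> U \<Longrightarrow> f differentiable (at x)"
    and step: "\<And>f j. P f \<Longrightarrow> \<exists>f'. P f' \<and> (\<forall>x\<in>U. dpart j f x = f' x)"
  shows "smooth_on_open U f"
proof -
  have "\<exists>f'. P f' \<and> (\<forall>x\<in>U. iter_part js f x = f' x)" for js
  proof (induction js)
    case Nil
    then show ?case using assms by auto
  next
    case (Cons j js)
    then obtain f' where f': "P f'" "\<forall>x\<in>U. iter_part js f x = f' x" by auto
    then obtain f'' where "P f''" "\<forall>x\<in>U. dpart j f' x = f'' x" using step by blast
    then show ?case using f' dpart_cong_open[OF assms(1)] by (metis iter_part.simps(2))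
  qed
  moreover have "g differentiable (at x)" if "P f'" "\<forall>x\<in>U. g x = f' x" "x \<in> U" for g f' x
    using diff[OF that(1,3)] has_derivative_cong_open[OF assms(1) that(3), of g f'] that(2)
    unfolding differentiable_def by blast
  ultimately show ?thesis unfolding smooth_on_open_def using assms(1) by blast
qed

text \<open>Closing under all operations at once makes the class stable under partial derivatives:
  the sum, product and reciprocal rules express a partial of a member through other members. One
  derivative per rule then replaces formulas for iterated partials.\<close>

inductive smooth_closure :: "(real^'n::finite) set \<Rightarrow> (real^'n \<Rightarrow> real) \<Rightarrow> bool" for U where
  base: "smooth_on_open U f \<Longrightarrow> smooth_closure U f"
| add: "smooth_closure U f \<Longrightarrow> smooth_closure U g \<Longrightarrow> smooth_closure U (\<lambda>x. f x + g x)"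
| mult: "smooth_closure U f \<Longrightarrow> smooth_closure U g \<Longrightarrow> smooth_closure U (\<lambda>x. f x * g x)"
| const: "smooth_closure U (\<lambda>x. r)"
| inverse: "smooth_closure U f \<Longrightarrow> (\<And>x. x \<in> U \<Longrightarrow> f x \<noteq> 0) \<Longrightarrow> smooth_closure U (\<lambda>x. inverse (f x))"

lemma smooth_closure_step:
  assumes "smooth_closure U f"
  shows "(\<forall>x\<in>U. f differentiable (at x)) \<and> (\<forall>j. \<exists>f'. smooth_closure U f' \<and> (\<forall>x\<in>U. dpart j f x = f' x))"
  using assms
proof induction
  case (base f)
  then show ?case using smooth_closure.base smooth_on_openD smooth_on_open_dpart by blast
next
  case (add f g)
  have "\<exists>f'. smooth_closure U f' \<and> (\<forall>x\<in>U. dpart j (\<lambda>x. f x + g x) x = f' x)" for j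
  proof -
    obtain f' g' where *: "smooth_closure U f'" "\<forall>x\<in>U. dpart j f x = f' x"
        "smooth_closure U g'" "\<forall>x\<in>U. dpart j g x = g' x" using add.IH by meson
    have "dpart j (\<lambda>x. f x + g x) x = f' x + g' x" if "x \<in> U" for x
      using dpart_eq[OF has_derivative_add[OF has_derivative_dpart has_derivative_dpart], of f x g j] that add.IH *
      by (simp add: axis_def if_distrib[of "\<lambda>z. z * _"] cong: if_cong)
    moreover have "smooth_closure U (\<lambda>x. f' x + g' x)" by (intro smooth_closure.add *)
    ultimately show ?thesis by (intro exI conjI ballI) assumption+
  qed
  then show ?case using add.IH by (auto intro: differentiable_add)
next
  case (mult f g)
  have "\<exists>f'. smooth_closure U f' \<and> (\<forall>x\<in>U. dpart j (\<lambda>x. f x * g x) x = f' x)" for j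
  proof -
    obtain f' g' where *: "smooth_closure U f'" "\<forall>x\<in>U. dpart j f x = f' x"
        "smooth_closure U g'" "\<forall>x\<in>U. dpart j g x = g' x" using mult.IH by meson
    have "dpart j (\<lambda>x. f x * g x) x = f x * g' x + f' x * g x" if "x \<in> U" for x
      using dpart_eq[OF has_derivative_mult[OF has_derivative_dpart has_derivative_dpart], of f x g j] that mult.IH *
      by (simp add: axis_def if_distrib[of "\<lambda>z. z * _"] cong: if_cong)
    moreover have "smooth_closure U (\<lambda>x. f x * g' x + f' x * g x)"
      by (intro smooth_closure.add smooth_closure.mult * mult.hyps)
    ultimately show ?thesis by (intro exI conjI ballI) assumption+
  qed
  then show ?case using mult.IH by (auto intro: differentiable_mult)
next
  case (const r)
  have "dpart j (\<lambda>x. r) x = 0" for j x by (rule dpart_eq[where D = "\<lambda>_. 0"]) auto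
  then show ?case using smooth_closure.const by (intro conjI ballI allI exI[of _ "\<lambda>x. 0"]) auto
next
  case (inverse f)
  have "\<exists>f'. smooth_closure U f' \<and> (\<forall>x\<in>U. dpart j (\<lambda>x. inverse (f x)) x = f' x)" for j
  proof -
    obtain f' where *: "smooth_closure U f'" "\<forall>x\<in>U. dpart j f x = f' x" using inverse.IH by meson
    have "dpart j (\<lambda>x. inverse (f x)) x = - 1 * (inverse (f x) * f' x * inverse (f x))" if "x \<in> U" for x
      using dpart_eq[OF Deriv.has_derivative_inverse[OF _ has_derivative_dpart], of f x j] that inverse *
      by (simp add: axis_def if_distrib[of "\<lambda>z. z * _"] cong: if_cong)
    moreover have "smooth_closure U (\<lambda>x. - 1 * (inverse (f x) * f' x * inverse (f x)))"
      by (intro smooth_closure.mult smooth_closure.const smooth_closure.inverse * inverse.hyps)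
    ultimately show ?thesis by (intro exI conjI ballI) assumption+
  qed
  then show ?case using inverse by (auto intro: differentiable_inverse)
qed

lemma smooth_closure_imp_smooth: "open U \<Longrightarrow> smooth_closure U f \<Longrightarrow> smooth_on_open U f"
  by (rule smooth_on_open_coinduct[where P = "smooth_closure U"]) (use smooth_closure_step in blast)+

lemma smooth_on_open_const: "open U \<Longrightarrow> smooth_on_open U (\<lambda>x. r)"
  by (simp add: smooth_closure.const smooth_closure_imp_smooth)

lemma smooth_on_open_add:
  "smooth_on_open U f \<Longrightarrow> smooth_on_open U g \<Longrightarrow> smooth_on_open U (\<lambda>x. f x + g x)"
  by (rule smooth_closure_imp_smooth, simp add: smooth_on_open_def, intro smooth_closure.add smooth_closure.base)

lemma smooth_on_open_mult:
  "smooth_on_open U f \<Longrightarrow> smooth_on_open U g \<Longrightarrow> smooth_on_open U (\<lambda>x. f x * g x)"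
  by (rule smooth_closure_imp_smooth, simp add: smooth_on_open_def, intro smooth_closure.mult smooth_closure.base)

lemma smooth_on_open_divide:
  assumes "smooth_on_open U f" "smooth_on_open U g" "\<And>x. x \<in> U \<Longrightarrow> g x \<noteq> 0"
  shows "smooth_on_open U (\<lambda>x. f x / g x)"
  unfolding divide_inverse
proof (rule smooth_closure_imp_smooth)
  show "open U" using assms(1) smooth_on_open_def by blast
  show "smooth_closure U (\<lambda>x. f x * inverse (g x))"
    by (intro smooth_closure.mult smooth_closure.inverse smooth_closure.base assms)
qed

lemma smooth_on_open_sum:
  assumes "open U" "\<And>i. i \<in> I \<Longrightarrow> smooth_on_open U (f i)"
  shows "smooth_on_open U (\<lambda>x. \<Sum>i\<in>I. f i x)"
  using assms(2) by (induction I rule: infinite_finite_induct)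
    (auto intro: smooth_on_open_add smooth_on_open_const assms(1))

lemma smooth_on_open_prod:
  assumes "open U" "\<And>i. i \<in> I \<Longrightarrow> smooth_on_open U (f i)"
  shows "smooth_on_open U (\<lambda>x. \<Prod>i\<in>I. f i x)"
  using assms(2) by (induction I rule: infinite_finite_induct)
    (auto intro: smooth_on_open_mult smooth_on_open_const assms(1))

lemma smooth_on_open_component:
  fixes U :: "(real^'n::finite) set"
  assumes "open U"
  shows "smooth_on_open U (\<lambda>x. x $ k)"
proof -
  have d: "((\<lambda>x. x $ k) has_derivative (\<lambda>v. v $ k)) (at x)" for x :: "real^'n"
    by (intro bounded_linear.has_derivative[OF bounded_linear_vec_nth] has_derivative_ident)
  show ?thesis
  \<comment> \<open>The coordinate itself together with all constants is stable under partial
    derivatives.\<close>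
  proof (rule smooth_on_open_coinduct[where P = "\<lambda>f. f = (\<lambda>x. x $ k) \<or> (\<exists>r. f = (\<lambda>x. r))", OF assms])
    fix f :: "real^'n \<Rightarrow> real" and j
    assume "f = (\<lambda>x. x $ k) \<or> (\<exists>r. f = (\<lambda>x. r))"
    then show "\<exists>f'. (f' = (\<lambda>x. x $ k) \<or> (\<exists>r. f' = (\<lambda>x. r))) \<and> (\<forall>x\<in>U. dpart j f x = f' x)"
    proof
      assume "f = (\<lambda>x. x $ k)"
      then show ?thesis using dpart_eq[OF d] by auto
    next
      assume "\<exists>r. f = (\<lambda>x. r)"
      then show ?thesis using dpart_eq[of f "\<lambda>_. 0"] by (intro exI[of _ "\<lambda>_. 0"]) auto
    qed
  qed (use d in \<open>auto intro: differentiableI\<close>)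
qed

lemma dpart_mult:
  assumes "f differentiable (at x)" "g differentiable (at x)"
  shows "dpart j (\<lambda>x. f x * g x) x = f x * dpart j g x + dpart j f x * g x"
  using dpart_eq[OF has_derivative_mult[OF assms[THEN has_derivative_dpart]], of j]
  by (simp add: axis_def if_distrib[of "\<lambda>z. z * _"] cong: if_cong)

lemma dpart_sum:
  assumes "finite I" "\<And>i. i \<in> I \<Longrightarrow> f i differentiable (at x)"
  shows "dpart j (\<lambda>x. \<Sum>i\<in>I. f i x) x = (\<Sum>i\<in>I. dpart j (f i) x)"
proof -
  have "((\<lambda>x. \<Sum>i\<in>I. f i x) has_derivative (\<lambda>v. \<Sum>i\<in>I. frechet_derivative (f i) (at x) v)) (at x)"
    by (intro has_derivative_sum) (use assms frechet_derivative_works in blast)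
  from dpart_eq[OF this] show ?thesis by (simp add: dpart_def)
qed

section \<open>Averages along segments\<close>

lemma smooth_on_open_has_derivative:
  "smooth_on_open U f \<Longrightarrow> x \<in> U \<Longrightarrow> (f has_derivative (\<lambda>v. \<Sum>j\<in>UNIV. v $ j * dpart j f x)) (at x)"
  by (intro has_derivative_dpart smooth_on_openD)

lemma convex_segment_point:
  fixes x y :: "'a::real_vector"
  assumes "convex U" "x \<in> U" "y \<in> U" "t \<in> {0..1}"
  shows "x + t *\<^sub>R (y - x) \<in> U"
proof -
  have "(1 - t) *\<^sub>R x + t *\<^sub>R y \<in> U" using assms by (intro convexD) auto
  then show ?thesis by (simp add: algebra_simps)
qed

text \<open>The exponent \<open>m\<close> counts the derivatives already taken: each derivative in
  \<open>y\<close> brings out one more factor \<open>t\<close> by the chain rule.\<close>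

definition segment_average :: "real^'n::finite \<Rightarrow> nat \<Rightarrow> (real^'n \<Rightarrow> real) \<Rightarrow> real^'n \<Rightarrow> real" where
  "segment_average x m F y = integral {0..1} (\<lambda>t. t ^ m * F (x + t *\<^sub>R (y - x)))"

lemma has_derivative_segment_average:
  fixes F :: "real^'n::finite \<Rightarrow> real"
  assumes F: "smooth_on_open U F" and U: "convex U" and x: "x \<in> U" and y: "y \<in> U"
  shows "(segment_average x m F has_derivative
    (\<lambda>v. \<Sum>k\<in>UNIV. v $ k * segment_average x (Suc m) (dpart k F) y)) (at y)"
proof -
  \<comment> \<open>\<open>leibniz_rule\<close> wants the derivative of the integrand as a bounded
    linear function object, jointly continuous in \<open>y\<close> and \<open>t\<close>; the
    exponent \<open>Suc m\<close> includes the chain rule factor.\<close>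
  define fx where "fx = (\<lambda>y t. t ^ Suc m *\<^sub>R (\<Sum>k\<in>UNIV. dpart k F (x + t *\<^sub>R (y - x)) *\<^sub>R Blinfun (\<lambda>v::real^'n. v $ k)))"
  have bl: "blinfun_apply (Blinfun (\<lambda>v::real^'n. v $ k)) v = v $ k" for k v
    by (simp add: bounded_linear_Blinfun_apply bounded_linear_vec_nth)
  have fx: "blinfun_apply (fx y t) v = t ^ Suc m * (\<Sum>k\<in>UNIV. v $ k * dpart k F (x + t *\<^sub>R (y - x)))" for y t v
    by (simp add: fx_def blinfun.scaleR_left blinfun.sum_left bl mult.commute)
  have cont: "continuous_on (U \<times> cbox 0 1) (\<lambda>(y, t). f (x + t *\<^sub>R (y - x)))" if "continuous_on U f" for f :: "real^'n \<Rightarrow> real"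
    unfolding split_def
    by (rule continuous_on_compose2[OF that]) (auto intro!: continuous_intros convex_segment_point[OF U x])
  have contF: "continuous_on {0..1} (\<lambda>t. f (x + t *\<^sub>R (y - x)))" if "continuous_on U f" "y \<in> U" for f :: "real^'n \<Rightarrow> real" and y
    by (rule continuous_on_compose2[OF that(1)]) (use that in \<open>auto intro!: continuous_intros convex_segment_point[OF U x]\<close>)
  have dF: "continuous_on U (dpart k F)" for k
    using F smooth_on_open_dpart smooth_on_open_continuous_on by blast
  have cfx: "continuous_on (U \<times> cbox 0 1) (\<lambda>(y, t). fx y t)"
    unfolding fx_def split_def
    by (intro continuous_intros cont[OF dF, unfolded split_def])
  have "((\<lambda>y. integral (cbox 0 1) (\<lambda>t. t ^ m * F (x + t *\<^sub>R (y - x)))) has_derivative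
      blinfun_apply (integral (cbox 0 1) (fx y))) (at y within U)"
  proof (rule leibniz_rule)
    fix y t assume yt: "y \<in> U" "t \<in> cbox (0::real) 1"
    then have "x + t *\<^sub>R (y - x) \<in> U" using convex_segment_point[OF U x] by simp
    then have dF: "(F has_derivative (\<lambda>v. \<Sum>j\<in>UNIV. v $ j * dpart j F (x + t *\<^sub>R (y - x)))) (at (x + t *\<^sub>R (y - x)))"
      using F smooth_on_open_has_derivative by blast
    have "((\<lambda>y. x + t *\<^sub>R (y - x)) has_derivative (\<lambda>v. t *\<^sub>R v)) (at y)"
      by (auto intro!: derivative_eq_intros)
    from has_derivative_compose[OF this dF] have "((\<lambda>y. F (x + t *\<^sub>R (y - x))) has_derivative (\<lambda>v. \<Sum>j\<in>UNIV. (t *\<^sub>R v) $ j * dpart j F (x + t *\<^sub>R (y - x)))) (at y)"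
      .
    then have "((\<lambda>y. t ^ m * F (x + t *\<^sub>R (y - x))) has_derivative (\<lambda>v. t ^ m * (\<Sum>j\<in>UNIV. (t *\<^sub>R v) $ j * dpart j F (x + t *\<^sub>R (y - x))))) (at y)"
      by (rule has_derivative_mult_right)
    moreover have "(\<lambda>v. t ^ m * (\<Sum>j\<in>UNIV. (t *\<^sub>R v) $ j * dpart j F (x + t *\<^sub>R (y - x)))) = blinfun_apply (fx y t)"
      by (rule ext) (simp add: fx sum_distrib_left mult_ac)
    ultimately show "((\<lambda>y. t ^ m * F (x + t *\<^sub>R (y - x))) has_derivative blinfun_apply (fx y t)) (at y within U)"
      by (simp add: has_derivative_at_withinI)
  next
    fix y assume "y \<in> U"
    then show "(\<lambda>t. t ^ m * F (x + t *\<^sub>R (y - x))) integrable_on cbox 0 1"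
      by (auto intro!: integrable_continuous_real continuous_intros contF smooth_on_open_continuous_on[OF F])
  qed (use cfx y U in auto)
  moreover have U_at: "at y within U = at y" using at_within_open[OF y] F unfolding smooth_on_open_def by blast
  moreover have ap: "blinfun_apply (integral (cbox 0 1) (fx y)) v = (\<Sum>k\<in>UNIV. v $ k * segment_average x (Suc m) (dpart k F) y)" for v
  proof -
    have "continuous_on {0..1} (fx y)"
      unfolding fx_def by (intro continuous_intros contF[OF dF y])
    then have "(fx y) integrable_on cbox 0 1" by (simp add: integrable_continuous_real)
    then have "blinfun_apply (integral (cbox 0 1) (fx y)) v = integral (cbox 0 1) ((\<lambda>b. blinfun_apply b v) \<circ> fx y)"
      by (subst integral_linear) (auto intro: blinfun.bounded_linear_left)
    also have "\<dots> = integral {0..1} (\<lambda>t. \<Sum>k\<in>UNIV. v $ k * (t ^ Suc m * dpart k F (x + t *\<^sub>R (y - x))))"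
      by (simp add: o_def fx sum_distrib_left mult_ac)
    also have "\<dots> = (\<Sum>k\<in>UNIV. integral {0..1} (\<lambda>t. v $ k * (t ^ Suc m * dpart k F (x + t *\<^sub>R (y - x)))))"
      by (rule integral_sum) (auto intro!: integrable_continuous_real continuous_intros contF[OF dF y])
    finally show ?thesis by (simp add: segment_average_def)
  qed
  ultimately have "(segment_average x m F has_derivative blinfun_apply (integral (cbox 0 1) (fx y))) (at y)"
    by (simp add: segment_average_def[abs_def])
  moreover have "blinfun_apply (integral (cbox 0 1) (fx y)) = (\<lambda>v. \<Sum>k\<in>UNIV. v $ k * segment_average x (Suc m) (dpart k F) y)"
    using ap by (rule ext)
  ultimately show ?thesis by simp
qed

lemma iter_part_segment_average:
  assumes F: "smooth_on_open U F" and U: "convex U" and x: "x \<in> U"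
  shows "y \<in> U \<Longrightarrow> iter_part js (segment_average x m F) y = segment_average x (m + length js) (iter_part js F) y"
proof (induction js arbitrary: y)
  case (Cons j js)
  have o: "open U" using F smooth_on_open_def by blast
  have "iter_part (j # js) (segment_average x m F) y = dpart j (segment_average x (m + length js) (iter_part js F)) y"
    using dpart_cong_open[OF o Cons.prems Cons.IH] by simp
  also have "\<dots> = segment_average x (Suc (m + length js)) (dpart j (iter_part js F)) y"
    using dpart_eq[OF has_derivative_segment_average[OF smooth_on_open_iter_part[OF F] U x Cons.prems]]
    by (simp add: axis_def if_distrib[of "\<lambda>z. z * _"] cong: if_cong)
  finally show ?case by simp
qed simp

lemma smooth_segment_average:
  assumes F: "smooth_on_open U F" and U: "convex U" and x: "x \<in> U"
  shows "smooth_on_open U (segment_average x m F)"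
proof -
  have o: "open U" using F smooth_on_open_def by blast
  have "iter_part js (segment_average x m F) differentiable (at y)" if "y \<in> U" for js y
    by (rule differentiableI, subst has_derivative_cong_open[OF o that iter_part_segment_average[OF F U x]], assumption)
      (rule has_derivative_segment_average[OF smooth_on_open_iter_part[OF F] U x that])
  then show ?thesis using o unfolding smooth_on_open_def by blast
qed

text \<open>At the base point the segment collapses and only the integral of \<open>t ^ m\<close> is
  left. This is the origin of the division by \<open>length js\<close> in
  \<open>tcoef\<close>.\<close>

lemma segment_average_self: "segment_average x m F x = F x / (real m + 1)"
proof -
  have "((\<lambda>t::real. t ^ m) has_integral (1 ^ Suc m / Suc m - 0 ^ Suc m / Suc m)) {0..1}"
    by (rule fundamental_theorem_of_calculus)
      (auto intro!: derivative_eq_intros simp: has_real_derivative_iff_has_vector_derivative[symmetric] simp del: power_Suc)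
  then have "integral {0..1} (\<lambda>t::real. t ^ m) = 1 / (real m + 1)"
    by (simp add: integral_unique add.commute)
  then show ?thesis by (simp add: segment_average_def)
qed

text \<open>The fundamental theorem of calculus along the segment from \<open>x\<close> to
  \<open>y\<close>, which convexity keeps inside \<open>U\<close>.\<close>

lemma hadamard_expansion:
  fixes F :: "real^'n::finite \<Rightarrow> real"
  assumes F: "smooth_on_open U F" and U: "convex U" and x: "x \<in> U" and y: "y \<in> U"
  shows "F y = F x + (\<Sum>j\<in>UNIV. (y $ j - x $ j) * segment_average x 0 (dpart j F) y)"
proof -
  have contF: "continuous_on {0..1} (\<lambda>t. f (x + t *\<^sub>R (y - x)))" if "continuous_on U f" for f :: "real^'n \<Rightarrow> real"
    by (rule continuous_on_compose2[OF that(1)]) (auto intro!: continuous_intros convex_segment_point[OF U x y])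
  have dF: "continuous_on U (dpart k F)" for k
    using F smooth_on_open_dpart smooth_on_open_continuous_on by blast
  have "((\<lambda>t. \<Sum>j\<in>UNIV. (y - x) $ j * dpart j F (x + t *\<^sub>R (y - x))) has_integral F (x + 1 *\<^sub>R (y - x)) - F (x + 0 *\<^sub>R (y - x))) {0..1}"
  proof (rule fundamental_theorem_of_calculus)
    fix t assume t: "t \<in> {0..1::real}"
    have dF: "(F has_derivative (\<lambda>v. \<Sum>j\<in>UNIV. v $ j * dpart j F (x + t *\<^sub>R (y - x)))) (at (x + t *\<^sub>R (y - x)))"
      using F smooth_on_open_has_derivative convex_segment_point[OF U x y t] by blast
    have "((\<lambda>t. x + t *\<^sub>R (y - x)) has_derivative (\<lambda>s. s *\<^sub>R (y - x))) (at t)"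
      by (auto intro!: derivative_eq_intros)
    from has_derivative_compose[OF this dF] have "((\<lambda>t. F (x + t *\<^sub>R (y - x))) has_derivative (\<lambda>s. \<Sum>j\<in>UNIV. (s *\<^sub>R (y - x)) $ j * dpart j F (x + t *\<^sub>R (y - x)))) (at t)"
      .
    then have "((\<lambda>t. F (x + t *\<^sub>R (y - x))) has_vector_derivative (\<Sum>j\<in>UNIV. (y - x) $ j * dpart j F (x + t *\<^sub>R (y - x)))) (at t)"
      unfolding has_vector_derivative_def by (simp add: sum_distrib_left mult.assoc)
    then show "((\<lambda>t. F (x + t *\<^sub>R (y - x))) has_vector_derivative (\<Sum>j\<in>UNIV. (y - x) $ j * dpart j F (x + t *\<^sub>R (y - x)))) (at t within {0..1})"
      using has_vector_derivative_at_within by blast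
  qed simp
  then have "F y - F x = integral {0..1} (\<lambda>t. \<Sum>j\<in>UNIV. (y - x) $ j * dpart j F (x + t *\<^sub>R (y - x)))"
    by (simp add: integral_unique)
  also have "\<dots> = (\<Sum>j\<in>UNIV. integral {0..1} (\<lambda>t. (y - x) $ j * dpart j F (x + t *\<^sub>R (y - x))))"
    by (rule integral_sum) (auto intro!: integrable_continuous_real continuous_intros contF[OF dF])
  finally show ?thesis by (simp add: segment_average_def)
qed

section \<open>The saddle point system\<close>

lemma smooth_det:
  assumes "open U" "\<And>i j. i < m \<Longrightarrow> j < m \<Longrightarrow> smooth_on_open U (A i j)"
  shows "smooth_on_open U (\<lambda>y. Determinant.det (Matrix.mat m m (\<lambda>(i, j). A i j y)))"
proof -
  have pl: "p i < m" if "p permutes {0..<m}" "i < m" for p and i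
    using permutes_in_image[OF that(1), of i] that(2) by simp
  have "Determinant.det (Matrix.mat m m (\<lambda>(i, j). A i j y)) =
      (\<Sum>p | p permutes {0..<m}. signof p * (\<Prod>i = 0..<m. A i (p i) y))" for y
    by (subst det_def'[of _ m]) (auto intro!: sum.cong prod.cong simp: pl)
  then show ?thesis using assms
    by (auto intro!: smooth_on_open_sum smooth_on_open_mult smooth_on_open_const smooth_on_open_prod simp: pl)
qed

lemma smooth_adj_mat:
  assumes "open U" "\<And>i j. i < m \<Longrightarrow> j < m \<Longrightarrow> smooth_on_open U (A i j)" and kl: "k < m" "l < m"
  shows "smooth_on_open U (\<lambda>y. adj_mat (Matrix.mat m m (\<lambda>(i, j). A i j y)) $$ (k, l))"
proof -
  \<comment> \<open>\<open>s k\<close> enumerates the indices other than \<open>k\<close>, so that a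
    minor is again a matrix of the form treated by \<open>smooth_det\<close>.\<close>
  define s where "s = (\<lambda>(k::nat) i. if i < k then i else Suc i)"
  have s: "i < m - 1 \<Longrightarrow> k < m \<Longrightarrow> s k i < m" for i k by (auto simp: s_def)
  have "mat_delete (Matrix.mat m m (\<lambda>(i, j). A i j y)) l k
      = Matrix.mat (m - 1) (m - 1) (\<lambda>(i, j). A (s l i) (s k j) y)" for y
    using kl by (intro eq_matI) (auto simp: mat_delete_def s_def)
  then have "adj_mat (Matrix.mat m m (\<lambda>(i, j). A i j y)) $$ (k, l) =
      (- 1) ^ (l + k) * Determinant.det (Matrix.mat (m - 1) (m - 1) (\<lambda>(i, j). A (s l i) (s k j) y))" for y
    using kl by (simp add: adj_mat_def cofactor_def)
  then show ?thesis using assms s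
    by (auto intro!: smooth_on_open_mult smooth_on_open_const smooth_det)
qed

text \<open>The inverse is the adjugate divided by the determinant, both polynomial in the entries.
  A trivial kernel at the points of \<open>S\<close> makes the determinant nonzero there, and
  continuity extends this to an open set.\<close>

lemma smooth_cramer:
  fixes A :: "nat \<Rightarrow> nat \<Rightarrow> real^'n::finite \<Rightarrow> real"
  assumes U: "open U" "S \<subseteq> U" and A: "\<And>i j. i < m \<Longrightarrow> j < m \<Longrightarrow> smooth_on_open U (A i j)"
    and inj: "\<And>y z. y \<in> S \<Longrightarrow> (\<And>i. i < m \<Longrightarrow> (\<Sum>k<m. A i k y * z k) = 0) \<Longrightarrow> (\<And>k. k < m \<Longrightarrow> z k = 0)"
  obtains V B where "open V" "S \<subseteq> V" "\<And>i j. i < m \<Longrightarrow> j < m \<Longrightarrow> smooth_on_open V (B i j)"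
    "\<And>y i j. y \<in> V \<Longrightarrow> i < m \<Longrightarrow> j < m \<Longrightarrow> (\<Sum>k<m. A i k y * B k j y) = (if i = j then 1 else 0)"
proof -
  define M where "M = (\<lambda>y. Matrix.mat m m (\<lambda>(i, j). A i j y))"
  define D where "D = (\<lambda>y. Determinant.det (M y))"
  define V where "V = {y \<in> U. D y \<noteq> 0}"
  define B where "B = (\<lambda>k j y. adj_mat (M y) $$ (k, j) / D y)"
  have M: "M y \<in> carrier_mat m m" for y by (simp add: M_def)
  have D: "smooth_on_open U D" unfolding D_def M_def by (rule smooth_det) (use U A in auto)
  have "V = U \<inter> D -` (- {0})" by (auto simp: V_def)
  then have V: "open V"
    using continuous_open_preimage[OF smooth_on_open_continuous_on[OF D] U(1)] by auto
  have SV: "S \<subseteq> V"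
  proof
    fix y assume y: "y \<in> S"
    have "D y \<noteq> 0"
    proof
      assume "D y = 0"
      then obtain v where v: "v \<in> carrier_vec m" "v \<noteq> 0\<^sub>v m" "M y *\<^sub>v v = 0\<^sub>v m"
        using det_0_iff_vec_prod_zero_field[OF M] D_def by metis
      have "(\<Sum>k<m. A i k y * vec_index v k) = 0" if "i < m" for i
      proof -
        have "vec_index (M y *\<^sub>v v) i = (\<Sum>k<m. A i k y * vec_index v k)"
          using that v(1) by (auto simp: M_def scalar_prod_def row_def atLeast0LessThan intro!: sum.cong)
        then show ?thesis using v that by simp
      qed
      then have "\<And>k. k < m \<Longrightarrow> vec_index v k = 0" using inj[OF y, of "vec_index v"] by blast
      then have "v = 0\<^sub>v m" using v(1) by (intro eq_vecI) auto
      then show False using v by blast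
    qed
    then show "y \<in> V" using y U by (auto simp: V_def)
  qed
  have smB: "smooth_on_open V (B i j)" if "i < m" "j < m" for i j
    unfolding B_def
  proof (rule smooth_on_open_divide)
    show "smooth_on_open V (\<lambda>y. adj_mat (M y) $$ (i, j))"
      unfolding M_def
      by (rule smooth_adj_mat) (use A V that in \<open>auto intro: smooth_on_open_subset simp: V_def\<close>)
    show "smooth_on_open V D" using D V by (auto intro: smooth_on_open_subset simp: V_def)
  qed (simp add: V_def)
  have "(\<Sum>k<m. A i k y * B k j y) = (if i = j then 1 else 0)" if "y \<in> V" "i < m" "j < m" for y i j
  proof -
    have "(\<Sum>k<m. A i k y * adj_mat (M y) $$ (k, j)) = (M y * adj_mat (M y)) $$ (i, j)"
      using that adj_mat(1)[OF M, of y]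
      by (auto simp: times_mat_def scalar_prod_def M_def row_def col_def atLeast0LessThan intro!: sum.cong)
    also have "\<dots> = (if i = j then D y else 0)"
      using that by (simp add: adj_mat(2)[OF M] D_def)
    finally show ?thesis using that unfolding B_def times_divide_eq_right sum_divide_distrib[symmetric]
      by (simp add: V_def)
  qed
  then show ?thesis using V SV smB by (intro that[of V B])
qed

lemma smooth_lat_dist: "open U \<Longrightarrow> smooth_on_open U (lat_dist u c i)"
proof -
  assume U: "open U"
  have eq: "lat_dist u c i = (\<lambda>x. of_int (c i) + (\<Sum>j\<in>UNIV. of_int (- u i $ j) * x $ j))"
    by (simp add: lat_dist_def fun_eq_iff sum_negf)
  show ?thesis unfolding eq
    by (intro U smooth_on_open_add smooth_on_open_sum smooth_on_open_mult smooth_on_open_const smooth_on_open_component)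
qed

lemma sum_lessThan_add: "(\<Sum>k<d + n. f k) = (\<Sum>k<d. f k) + (\<Sum>k<n. f (d + k))" for f :: "nat \<Rightarrow> real"
  by (induction n) (auto simp: add.assoc)

text \<open>The pair \<open>(W, G)\<close> solves the saddle point system with block matrix \<open>((L, -u), (u\<^sup>T, 0))\<close>,
  \<open>L = diag \<ell>\<^sub>i\<close>. In the interior this says that \<open>G\<close> inverts the Hessian
  \<open>\<Sum>i. u\<^sub>i u\<^sub>i\<^sup>T / \<ell>\<^sub>i\<close>, but the system stays invertible up to the boundary.\<close>
lemma smooth_saddle_point:
  fixes u :: "nat \<Rightarrow> int^'n::finite"
  assumes full: "\<And>g :: 'n \<Rightarrow> real. (\<And>i. i < d \<Longrightarrow> (\<Sum>j\<in>UNIV. of_int (u i $ j) * g j) = 0) \<Longrightarrow> (\<And>j. g j = 0)"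
    and indep: "\<And>y w. y \<in> poly_set d u c \<Longrightarrow> (\<And>i. i < d \<Longrightarrow> lat_dist u c i y \<noteq> 0 \<Longrightarrow> w i = 0) \<Longrightarrow>
      (\<And>j. (\<Sum>i<d. of_int (u i $ j) * w i) = (0::real)) \<Longrightarrow> (\<And>i. i < d \<Longrightarrow> w i = 0)"
  obtains V G W where "open V" "poly_set d u c \<subseteq> V"
    "\<And>k j. smooth_on_open V (G k j :: real^'n \<Rightarrow> real)" "\<And>i j. i < d \<Longrightarrow> smooth_on_open V (W i j)"
    "\<And>i j y. i < d \<Longrightarrow> y \<in> V \<Longrightarrow> (\<Sum>k\<in>UNIV. of_int (u i $ k) * G k j y) = lat_dist u c i y * W i j y"
    "\<And>k j y. y \<in> V \<Longrightarrow> (\<Sum>i<d. of_int (u i $ k) * W i j y) = (if k = j then 1 else 0)"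
proof -
  define n where "n = CARD('n)"
  obtain e where "bij_betw e {0..<n} (UNIV :: 'n set)"
    unfolding n_def using ex_bij_betw_nat_finite[of "UNIV :: 'n set"] by auto
  then have e: "bij_betw e {..<n} UNIV" by (simp add: atLeast0LessThan)
  define e' where "e' = the_inv_into {..<n} e"
  have e'_less: "e' j < n" for j
    using bij_betwE[OF bij_betw_the_inv_into[OF e]] by (auto simp: e'_def)
  have ee': "e (e' j) = j" for j
    unfolding e'_def using e by (metis UNIV_I bij_betw_def f_the_inv_into_f)
  have sum_e: "(\<Sum>k<n. f (e k)) = (\<Sum>j\<in>UNIV. f j)" for f :: "'n \<Rightarrow> real"
    by (rule sum.reindex_bij_betw[OF e])
  have e'e: "k < n \<Longrightarrow> e' (e k) = k" for k
    unfolding e'_def using e by (simp add: bij_betw_def the_inv_into_f_f)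
  \<comment> \<open>Indices below \<open>d\<close> stand for facets, the remaining \<open>n\<close>
    for coordinates, numbered by \<open>e\<close>.\<close>
  define A where "A = (\<lambda>i k (y :: real^'n). if i < d
     then (if k < d then if k = i then lat_dist u c i y else 0 else - of_int (u i $ e (k - d)))
     else (if k < d then of_int (u k $ e (i - d)) else 0))"
  have sm: "smooth_on_open UNIV (A i k)" for i k
    unfolding A_def by (cases "i < d"; cases "k < d"; cases "k = i")
      (auto intro: smooth_on_open_const smooth_lat_dist)
  have row1: "(\<Sum>k<d + n. A i k y * z k) = lat_dist u c i y * z i - (\<Sum>j\<in>UNIV. of_int (u i $ j) * z (d + e' j))"
    if "i < d" for i y z
  proof -
    have "(\<Sum>k<d. A i k y * z k) = (\<Sum>k<d. if k = i then lat_dist u c i y * z i else 0)"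
      using that by (intro sum.cong) (auto simp: A_def)
    moreover have "(\<Sum>k<n. A i (d + k) y * z (d + k)) = (\<Sum>k<n. - of_int (u i $ e k) * z (d + e' (e k)))"
      using that by (intro sum.cong) (auto simp: A_def e'e)
    ultimately show ?thesis using that
      by (simp add: sum_lessThan_add sum_e[of "\<lambda>j. of_int (u i $ j) * z (d + e' j)"] sum_negf)
  qed
  have row2: "(\<Sum>k<d + n. A (d + e' r) k y * z k) = (\<Sum>i<d. of_int (u i $ r) * z i)" for r y z
    by (simp add: sum_lessThan_add A_def ee')
  obtain V B where V: "open V" "poly_set d u c \<subseteq> V"
    and B: "\<And>i j. i < d + n \<Longrightarrow> j < d + n \<Longrightarrow> smooth_on_open V (B i j)"
    and AB: "\<And>y i j. y \<in> V \<Longrightarrow> i < d + n \<Longrightarrow> j < d + n \<Longrightarrow>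
      (\<Sum>k<d + n. A i k y * B k j y) = (if i = j then 1 else 0)"
  proof (rule smooth_cramer[of UNIV "poly_set d u c" "d + n" A])
    fix y z k
    assume y: "y \<in> poly_set d u c" and k: "k < d + n"
      and 0: "\<And>i. i < d + n \<Longrightarrow> (\<Sum>k<d + n. A i k y * z k) = 0"
    have r1: "lat_dist u c i y * z i = (\<Sum>j\<in>UNIV. of_int (u i $ j) * z (d + e' j))" if "i < d" for i
      using 0[of i] row1[OF that, of y z] that by simp
    have r2: "(\<Sum>i<d. of_int (u i $ r) * z i) = 0" for r
      using 0[of "d + e' r"] row2[of r y z] e'_less[of r] by simp
    have nn: "0 \<le> lat_dist u c i y" if "i < d" for i using y that by (auto simp: poly_set_def)
    \<comment> \<open>Energy argument: pairing the facet rows with \<open>z\<close> and using the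
      coordinate rows gives zero. All summands are nonnegative on the polytope, so
      \<open>z i\<close> vanishes unless facet \<open>i\<close> contains \<open>y\<close>, and there
      \<open>indep\<close> takes over.\<close>
    have "(\<Sum>i<d. lat_dist u c i y * z i ^ 2) = (\<Sum>i<d. \<Sum>j\<in>UNIV. z (d + e' j) * (of_int (u i $ j) * z i))"
    proof (rule sum.cong)
      fix i assume "i \<in> {..<d}"
      then have "lat_dist u c i y * z i ^ 2 = (\<Sum>j\<in>UNIV. of_int (u i $ j) * z (d + e' j)) * z i"
        using r1 by (simp add: power2_eq_square)
      then show "lat_dist u c i y * z i ^ 2 = (\<Sum>j\<in>UNIV. z (d + e' j) * (of_int (u i $ j) * z i))"
        unfolding sum_distrib_right by (simp add: mult_ac)
    qed simp
    also have "\<dots> = (\<Sum>j\<in>UNIV. z (d + e' j) * (\<Sum>i<d. of_int (u i $ j) * z i))"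
      by (subst sum.swap) (simp add: sum_distrib_left)
    finally have "(\<Sum>i<d. lat_dist u c i y * z i ^ 2) = 0" by (simp add: r2)
    then have "lat_dist u c i y * z i ^ 2 = 0" if "i < d" for i
      using that nn by (subst (asm) sum_nonneg_eq_0_iff) auto
    then have z1: "z i = 0" if "i < d" for i
      using indep[OF y, of z] r2 that by auto
    then have "(\<Sum>j\<in>UNIV. of_int (u i $ j) * z (d + e' j)) = 0" if "i < d" for i
      using r1[OF that] that by simp
    then have "z (d + e' j) = 0" for j using full[of "\<lambda>j. z (d + e' j)"] by blast
    then have "z k = 0" if "\<not> k < d"
      using e'e[of "k - d"] k that by (metis le_add_diff_inverse less_diff_conv2 not_less add.commute)
    then show "z k = 0" using z1 by blast
  qed (use sm in auto)
  \<comment> \<open>The last \<open>n\<close> columns of the inverse supply both families: their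
    upper block is \<open>W\<close>, their lower block is \<open>G\<close>.\<close>
  show ?thesis
  proof (rule that[of V "\<lambda>k j. B (d + e' k) (d + e' j)" "\<lambda>i j. B i (d + e' j)"])
    show "(\<Sum>k\<in>UNIV. of_int (u i $ k) * B (d + e' k) (d + e' j) y) = lat_dist u c i y * B i (d + e' j) y"
      if "i < d" "y \<in> V" for i j y
      using AB[of y i "d + e' j"] row1[OF that(1), of y "\<lambda>k. B k (d + e' j) y"] that e'_less[of j] by simp
    show "(\<Sum>i<d. of_int (u i $ k) * B i (d + e' j) y) = (if k = j then 1 else 0)" if "y \<in> V" for k j y
      using AB[of y "d + e' k" "d + e' j"] row2[of k y "\<lambda>k. B k (d + e' j) y"] that e'_less[of j] e'_less[of k] ee'
      by (auto dest: arg_cong[of _ _ e])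
  qed (use V B e'_less in auto)
qed

text \<open>Here \<open>k j\<close> expands the \<open>j\<close>-th unit vector in \<open>B\<close>.
  Expanding \<open>b'\<close> through the unit vectors represents it over \<open>B\<close> a second
  time, and uniqueness of the integer coefficients yields biorthogonality.\<close>

lemma zbasis_dual:
  fixes B :: "(int^'n::finite) set"
  assumes "zbasis B"
  obtains k where "\<And>j l. (\<Sum>b\<in>B. k j b * b $ l) = (if l = j then 1 else 0)"
    "\<And>b b'. b \<in> B \<Longrightarrow> b' \<in> B \<Longrightarrow> (\<Sum>j\<in>UNIV. b' $ j * k j b) = (if b = b' then 1 else 0)"
proof -
  have fin: "finite B" using assms by (simp add: zbasis_def)
  have "\<forall>j. \<exists>k. \<forall>l. axis j (1::int) $ l = (\<Sum>b\<in>B. k b * b $ l)"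
    using assms unfolding zbasis_def by blast
  then obtain k where "\<And>j l. axis j (1::int) $ l = (\<Sum>b\<in>B. k j b * b $ l)" by metis
  then have k: "(\<Sum>b\<in>B. k j b * b $ l) = (if l = j then 1 else 0)" for j l
    by (simp add: axis_def)
  have "(\<Sum>j\<in>UNIV. b' $ j * k j b) = (if b = b' then 1 else 0)" if "b \<in> B" "b' \<in> B" for b b'
  proof -
    define q where "q = (\<lambda>b. (\<Sum>j\<in>UNIV. b' $ j * k j b) - (if b = b' then 1 else 0))"
    have "(\<Sum>b\<in>B. q b * b $ l) = 0" for l
    proof -
      have "(\<Sum>b\<in>B. q b * b $ l) = (\<Sum>b\<in>B. \<Sum>j\<in>UNIV. b' $ j * (k j b * b $ l)) - (\<Sum>b\<in>B. if b = b' then b $ l else 0)"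
        unfolding q_def left_diff_distrib sum_subtractf sum_distrib_right
        by (simp add: mult.assoc if_distrib[of "\<lambda>z. z * _"] cong: if_cong)
      also have "\<dots> = (\<Sum>j\<in>UNIV. b' $ j * (\<Sum>b\<in>B. k j b * b $ l)) - b' $ l"
        using that fin by (subst sum.swap) (simp add: sum_distrib_left)
      finally show ?thesis by (simp add: k if_distrib[of "\<lambda>z. _ * z"] cong: if_cong)
    qed
    then have "q b = 0" using assms that(1) unfolding zbasis_def by blast
    then show ?thesis by (simp add: q_def)
  qed
  with k show ?thesis using that by blast
qed

section \<open>Delzant polytopes\<close>

lemma lat_dist_diff: "lat_dist u c i x - lat_dist u c i y = (\<Sum>j\<in>UNIV. of_int (u i $ j) * (y $ j - x $ j))"
  by (simp add: lat_dist_def right_diff_distrib sum_subtractf)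

lemma lat_dist_affine:
  assumes "a + b = 1"
  shows "lat_dist u c i (a *\<^sub>R x + b *\<^sub>R y) = a * lat_dist u c i x + b * lat_dist u c i y"
proof -
  have "(\<Sum>j\<in>UNIV. of_int (u i $ j) * (a *\<^sub>R x + b *\<^sub>R y) $ j) =
      a * (\<Sum>j\<in>UNIV. of_int (u i $ j) * x $ j) + b * (\<Sum>j\<in>UNIV. of_int (u i $ j) * y $ j)"
    by (simp add: sum_distrib_left sum.distrib[symmetric] algebra_simps)
  moreover have "of_int (c i) = a * of_int (c i) + b * (of_int (c i) :: real)"
    using assms by (simp flip: distrib_right)
  ultimately show ?thesis unfolding lat_dist_def by (simp add: right_diff_distrib)
qed

lemma convex_poly_set: "convex (poly_set d u c)"
  by (auto simp: convex_def poly_set_def lat_dist_affine)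

lemma continuous_on_lat_dist: "continuous_on S (lat_dist u c i)"
  unfolding lat_dist_def by (intro continuous_intros)

lemma closed_lat_dist_zero: "closed {x. lat_dist u c i x = 0}"
  by (intro closed_Collect_eq continuous_on_lat_dist continuous_intros)

text \<open>The points where every constraint active at \<open>y\<close> stays active form a
  nonempty compact face. It has an extreme point, and an extreme point of a face is extreme in the
  whole polytope.\<close>

lemma vertex_below:
  assumes "compact (poly_set d u c)" "y \<in> poly_set d u c"
  obtains v where "v extreme_point_of poly_set d u c"
    "\<And>i. i < d \<Longrightarrow> lat_dist u c i y = 0 \<Longrightarrow> lat_dist u c i v = 0"
proof -
  define F where "F = {z \<in> poly_set d u c. \<forall>i<d. lat_dist u c i y = 0 \<longrightarrow> lat_dist u c i z = 0}"
  have eq: "F = poly_set d u c \<inter> (\<Inter>i\<in>{i. i < d \<and> lat_dist u c i y = 0}. {z. lat_dist u c i z = 0})"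
    by (auto simp: F_def)
  have "compact F" unfolding eq
    by (intro compact_Int_closed assms closed_INT ballI closed_lat_dist_zero)
  moreover have "convex F"
    using convex_poly_set[of d u c] by (auto simp: F_def convex_def lat_dist_affine)
  moreover have "F \<noteq> {}" using assms by (auto simp: F_def)
  ultimately obtain v where v: "v extreme_point_of F" using extreme_point_exists_convex by blast
  have "F face_of poly_set d u c"
    unfolding face_of_def
  proof (intro conjI ballI impI)
    show "F \<subseteq> poly_set d u c" by (auto simp: F_def)
    show "convex F" by fact
    fix a b z assume ab: "a \<in> poly_set d u c" "b \<in> poly_set d u c" "z \<in> F" "z \<in> open_segment a b"
    then obtain t where t: "0 < t" "t < 1" "z = (1 - t) *\<^sub>R a + t *\<^sub>R b" by (auto simp: in_segment)
    have "lat_dist u c i a = 0 \<and> lat_dist u c i b = 0" if "i < d" "lat_dist u c i y = 0" for i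
    proof -
      have "(1 - t) * lat_dist u c i a + t * lat_dist u c i b = 0"
        using ab(3) that t(3) lat_dist_affine[of "1 - t" t u c i a b] by (auto simp: F_def)
      moreover have "0 \<le> (1 - t) * lat_dist u c i a" "0 \<le> t * lat_dist u c i b"
        using ab t that by (auto simp: poly_set_def)
      ultimately have "(1 - t) * lat_dist u c i a = 0 \<and> t * lat_dist u c i b = 0" by linarith
      then show ?thesis using t by auto
    qed
    then show "a \<in> F" "b \<in> F" using ab by (auto simp: F_def)
  qed
  then have "v extreme_point_of poly_set d u c" "v \<in> F"
    using v extreme_point_of_face by blast+
  then show ?thesis by (intro that[of v]) (auto simp: F_def)
qed

text \<open>One vertex suffices: its normals generate the lattice, so each coordinate of
  \<open>g\<close> is an integer combination of the vanishing pairings.\<close>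

lemma delzant_full:
  fixes u :: "nat \<Rightarrow> int^'n::finite"
  assumes D: "delzant d u c" and 0: "\<And>i. i < d \<Longrightarrow> (\<Sum>l\<in>UNIV. of_int (u i $ l) * g l) = (0::real)"
  shows "g j = 0"
proof -
  have "poly_set d u c \<noteq> {}" "compact (poly_set d u c)" using D interior_subset by (auto simp: delzant_def)
  then obtain v where "v extreme_point_of poly_set d u c" using vertex_below by blast
  then have "zbasis (u ` {i. i < d \<and> lat_dist u c i v = 0})" using D by (auto simp: delzant_def)
  then obtain k where k: "\<And>j l. (\<Sum>b\<in>u ` {i. i < d \<and> lat_dist u c i v = 0}. k j b * b $ l) = (if l = j then 1 else 0)"
    by (rule zbasis_dual) (rule that)
  have "g j = (\<Sum>l\<in>UNIV. of_int (if l = j then 1 else 0) * g l)"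
    by (simp add: if_distrib[of of_int] if_distrib[of "\<lambda>z. z * _"] cong: if_cong)
  also have "\<dots> = (\<Sum>l\<in>UNIV. \<Sum>b\<in>u ` {i. i < d \<and> lat_dist u c i v = 0}. of_int (k j b) * (of_int (b $ l) * g l))"
    unfolding k[symmetric] by (simp add: sum_distrib_right mult.assoc)
  also have "\<dots> = (\<Sum>b\<in>u ` {i. i < d \<and> lat_dist u c i v = 0}. of_int (k j b) * (\<Sum>l\<in>UNIV. of_int (b $ l) * g l))"
    by (subst sum.swap) (simp add: sum_distrib_left)
  also have "\<dots> = 0" using 0 by (intro sum.neutral) auto
  finally show ?thesis .
qed

text \<open>The facets through \<open>y\<close> all pass through some vertex, where the normals form
  a basis. Since \<open>zbasis\<close> speaks of a set of vectors, injectivity of \<open>u\<close>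
  is what carries independence over to facet indices.\<close>

lemma delzant_indep:
  fixes u :: "nat \<Rightarrow> int^'n::finite"
  assumes D: "delzant d u c" and y: "y \<in> poly_set d u c"
    and w: "\<And>i. i < d \<Longrightarrow> lat_dist u c i y \<noteq> 0 \<Longrightarrow> w i = 0"
    and 0: "\<And>j. (\<Sum>i<d. of_int (u i $ j) * w i) = (0::real)" and i0: "i0 < d"
  shows "w i0 = 0"
proof (rule ccontr)
  assume ne: "w i0 \<noteq> 0"
  obtain v where v: "v extreme_point_of poly_set d u c"
    "\<And>i. i < d \<Longrightarrow> lat_dist u c i y = 0 \<Longrightarrow> lat_dist u c i v = 0"
    using vertex_below[OF _ y] D unfolding delzant_def by blast
  define Z where "Z = {i. i < d \<and> lat_dist u c i v = 0}"
  have "zbasis (u ` Z)" using D v by (auto simp: delzant_def Z_def)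
  then obtain k where k: "\<And>b b'. b \<in> u ` Z \<Longrightarrow> b' \<in> u ` Z \<Longrightarrow> (\<Sum>j\<in>UNIV. b' $ j * k j b) = (if b = b' then 1 else 0 :: int)"
    by (rule zbasis_dual) (rule that)
  have w0: "w i = 0" if "i < d" "i \<notin> Z" for i using w v(2) that by (auto simp: Z_def)
  have i0Z: "i0 \<in> Z" using w0 i0 ne by blast
  have inj: "inj_on u {..<d}" using D by (auto simp: delzant_def)
  \<comment> \<open>Pairing the relation with the vector dual to \<open>u i0\<close> isolates
    \<open>w i0\<close>.\<close>
  have "0 = (\<Sum>j\<in>UNIV. of_int (k j (u i0)) * (\<Sum>i<d. of_int (u i $ j) * w i))" by (simp add: 0)
  also have "\<dots> = (\<Sum>i<d. of_int (\<Sum>j\<in>UNIV. u i $ j * k j (u i0)) * w i)"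
    unfolding sum_distrib_left of_int_sum sum_distrib_right by (subst sum.swap) (simp add: mult_ac)
  also have "\<dots> = (\<Sum>i<d. if i = i0 then w i else 0)"
  proof (rule sum.cong)
    fix i assume i: "i \<in> {..<d}"
    show "of_int (\<Sum>j\<in>UNIV. u i $ j * k j (u i0)) * w i = (if i = i0 then w i else 0)"
    proof (cases "i \<in> Z")
      case True
      then show ?thesis using k[of "u i0" "u i"] i0Z inj_onD[OF inj, of i i0] i i0 by auto
    next
      case False
      then show ?thesis using w0 i by auto
    qed
  qed simp
  finally show False using ne i0 by simp
qed

lemma negligible_lat_dist_zero:
  assumes "primitive_vec (u i)"
  shows "negligible {x. lat_dist u c i x = 0}"
proof -
  have "u i \<noteq> 0"
  proof
    assume "u i = 0"
    \<comment> \<open>The zero vector is 2 times itself, which contradicts primitivity.\<close>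
    then have "(2::int) = 1 \<or> (2::int) = -1" using assms unfolding primitive_vec_def by (metis mult_zero_right zero_index)
    then show False by simp
  qed
  then obtain j where "u i $ j \<noteq> 0" by (auto simp: Finite_Cartesian_Product.vec_eq_iff)
  then have "(\<chi> j. real_of_int (u i $ j)) \<noteq> 0" by (auto simp: Finite_Cartesian_Product.vec_eq_iff)
  moreover have "{x. lat_dist u c i x = 0} = {x. (\<chi> j. real_of_int (u i $ j)) \<bullet> x = of_int (c i)}"
    by (auto simp: lat_dist_def inner_vec_def)
  ultimately show ?thesis using negligible_hyperplane by metis
qed

text \<open>Facets lie in hyperplanes, which are null sets. Limits may therefore be checked where
  every power has a positive base, away from the convention for 0^0.\<close>

lemma AE_lat_dist_pos:
  assumes "\<And>i. i < d \<Longrightarrow> primitive_vec (u i)"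
  shows "AE y in lborel. y \<in> poly_set d u c \<longrightarrow> (\<forall>i<d. 0 < lat_dist u c i y)"
proof -
  have "AE y in lborel. \<forall>i\<in>{..<d}. y \<notin> {x. lat_dist u c i x = 0}"
  proof (rule AE_finite_allI)
    fix i assume "i \<in> {..<d}"
    then have "{x. lat_dist u c i x = 0} \<in> null_sets lebesgue"
      using negligible_lat_dist_zero assms negligible_iff_null_sets by blast
    then have "{x. lat_dist u c i x = 0} \<in> null_sets lborel"
      using closed_lat_dist_zero[of u c i] by (subst (asm) null_sets_completion_iff) auto
    then show "AE y in lborel. y \<notin> {x. lat_dist u c i x = 0}" by (rule AE_not_in)
  qed simp
  then show ?thesis by eventually_elim (force simp: poly_set_def order.strict_iff_order)
qed

section \<open>Integration by parts\<close>

lemma lborel_integral_translate: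
  fixes h :: "'a::euclidean_space \<Rightarrow> real"
  assumes "h \<in> borel_measurable borel"
  shows "(\<integral>x. h (x + v) \<partial>lborel) = (\<integral>x. h x \<partial>lborel)"
proof -
  have "(\<integral>x. h x \<partial>distr lborel borel ((+) v)) = (\<integral>x. h (v + x) \<partial>lborel)"
    by (rule integral_distr) (use assms in auto)
  then show ?thesis by (simp add: lborel_distr_plus add.commute)
qed

text \<open>By translation invariance the difference quotients integrate to zero.\<close>
lemma integral_dpart_eq_0:
  fixes h :: "real^'n::finite \<Rightarrow> real"
  assumes diff: "\<And>x. h differentiable (at x)" and bound: "\<And>j x. \<bar>dpart j h x\<bar> \<le> C"
    and S: "bounded S" "\<And>x. x \<notin> S \<Longrightarrow> h x = 0"
  shows "integrable lborel (dpart k h)" "(\<integral>x. dpart k h x \<partial>lborel) = 0"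
proof -
  define v :: "real^'n" where "v = axis k 1"
  have nv: "norm v = 1" by (simp add: v_def)
  define s where "s = (\<lambda>n. inverse (real (Suc n)))"
  define q where "q = (\<lambda>n x. (h (x + s n *\<^sub>R v) - h x) / s n)"
  have s: "0 < s n" "s n \<le> 1" for n by (auto simp: s_def field_simps)
  have s0: "s \<longlonglongrightarrow> 0" unfolding s_def by (rule LIMSEQ_inverse_real_of_nat)
  have cont: "continuous_on UNIV h"
    using diff differentiable_imp_continuous_within continuous_at_imp_continuous_on by blast
  then have meas[measurable]: "h \<in> borel_measurable borel" by (rule borel_measurable_continuous_onI)
  obtain R where R: "\<And>x. x \<in> S \<Longrightarrow> norm x \<le> R" using S(1) bounded_iff by blast
  have h0: "h x = 0" if "norm x > R" for x using S(2)[of x] R[of x] that by force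
  have "continuous_on (cball 0 R) h" using cont continuous_on_subset by blast
  then have "integrable lborel (\<lambda>x. indicator (cball 0 R) x *\<^sub>R h x)" by (intro borel_integrable_compact) auto
  moreover have "(\<lambda>x. indicator (cball 0 R) x *\<^sub>R h x) = h"
    using h0 by (force simp: indicator_def fun_eq_iff)
  ultimately have int: "integrable lborel h" by simp
  have int': "integrable lborel (\<lambda>x. h (x + w))" for w
  proof -
    have "integrable (distr lborel borel ((+) w)) h" by (simp add: lborel_distr_plus int)
    then show ?thesis by (subst (asm) integrable_distr_eq) (auto simp: add.commute)
  qed
  have q0: "(\<integral>x. q n x \<partial>lborel) = 0" for n
    unfolding q_def using int int' by (simp add: lborel_integral_translate)
  have lim: "(\<lambda>n. q n x) \<longlonglongrightarrow> dpart k h x" for x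
  proof -
    have "((\<lambda>t. x + t *\<^sub>R v) has_derivative (\<lambda>t. t *\<^sub>R v)) (at 0)" by (auto intro!: derivative_eq_intros)
    moreover have "(h has_derivative (\<lambda>w. \<Sum>j\<in>UNIV. w $ j * dpart j h x)) (at (x + 0 *\<^sub>R v))"
      using has_derivative_dpart[OF diff] by simp
    ultimately have "((\<lambda>t. h (x + t *\<^sub>R v)) has_derivative (\<lambda>t. \<Sum>j\<in>UNIV. (t *\<^sub>R v) $ j * dpart j h x)) (at 0)"
      by (rule has_derivative_compose)
    moreover have "(\<lambda>t. \<Sum>j\<in>UNIV. (t *\<^sub>R v) $ j * dpart j h x) = (*) (dpart k h x)"
      by (auto simp: v_def axis_def fun_eq_iff if_distrib[of "\<lambda>z. z * _"] if_distrib[of "\<lambda>z. _ * z"] mult.commute cong: if_cong)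
    ultimately have "((\<lambda>t. h (x + t *\<^sub>R v)) has_real_derivative dpart k h x) (at 0)"
      by (simp add: has_field_derivative_def)
    then have "((\<lambda>t. (h (x + t *\<^sub>R v) - h x) / t) \<longlongrightarrow> dpart k h x) (at 0)"
      by (simp add: DERIV_def)
    moreover have "filterlim s (at 0) sequentially"
      using s0 s(1) by (auto simp: filterlim_at less_imp_neq[symmetric] intro!: always_eventually)
    ultimately show ?thesis unfolding q_def by (rule filterlim_compose)
  qed
  \<comment> \<open>The steps \<open>s n\<close> are at most 1, so every difference quotient
    vanishes outside the ball of radius \<open>R + 1\<close>; inside it the mean value inequality
    gives a bound independent of \<open>n\<close>.\<close>
  have qb: "norm (q n x) \<le> indicator (cball 0 (R + 1)) x *\<^sub>R (real CARD('n) * C)" for n x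
  proof (cases "norm x \<le> R + 1")
    case True
    have on: "onorm (\<lambda>w. \<Sum>j\<in>UNIV. w $ j * dpart j h z) \<le> real CARD('n) * C" for z
    proof (rule onorm_bound)
      show "0 \<le> real CARD('n) * C" using bound[of k z] by auto
      fix w :: "real^'n"
      have "norm (\<Sum>j\<in>UNIV. w $ j * dpart j h z) \<le> (\<Sum>j\<in>UNIV. \<bar>w $ j * dpart j h z\<bar>)" by (simp add: sum_abs)
      also have "\<dots> \<le> (\<Sum>j\<in>(UNIV :: 'n set). norm w * C)"
        using bound by (intro sum_mono) (simp add: abs_mult mult_mono component_le_norm_cart)
      finally show "norm (\<Sum>j\<in>UNIV. w $ j * dpart j h z) \<le> real CARD('n) * C * norm w" by (simp add: mult_ac)
    qed
    have "norm (h (x + s n *\<^sub>R v) - h x) \<le> real CARD('n) * C * norm (x + s n *\<^sub>R v - x)"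
      by (rule differentiable_bound[of UNIV h]) (use has_derivative_dpart[OF diff] on in auto)
    then have "\<bar>h (x + s n *\<^sub>R v) - h x\<bar> \<le> real CARD('n) * C * s n" using nv s[of n] by simp
    then show ?thesis using True s[of n] by (simp add: q_def field_simps)
  next
    case False
    then have "norm (x + s n *\<^sub>R v) > R" using nv s[of n] norm_diff_ineq[of x "s n *\<^sub>R v"] by simp
    then have "q n x = 0" using h0 False by (simp add: q_def)
    then show ?thesis using False by simp
  qed
  have qm: "q n \<in> borel_measurable lborel" for n unfolding q_def by measurable
  have dm: "dpart k h \<in> borel_measurable lborel"
    by (rule borel_measurable_LIMSEQ_real[where u = q]) (use lim qm in auto)
  have w: "integrable lborel (\<lambda>x. indicator (cball 0 (R + 1)) x *\<^sub>R (real CARD('n) * C) :: real)"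
    by (intro borel_integrable_compact) auto
  show "integrable lborel (dpart k h)"
    by (rule integrable_dominated_convergence[where s = q, OF dm qm w]) (use lim qb in auto)
  have "(\<lambda>n. \<integral>x. q n x \<partial>lborel) \<longlonglongrightarrow> (\<integral>x. dpart k h x \<partial>lborel)"
    by (rule integral_dominated_convergence[where s = q, OF dm qm w]) (use lim qb in auto)
  then show "(\<integral>x. dpart k h x \<partial>lborel) = 0" using LIMSEQ_unique by (auto simp: q0)
qed

section \<open>Damped one-dimensional weights\<close>

lemma DERIV_max_powr:
  assumes "b > 1"
  shows "((\<lambda>s::real. max 0 s powr b) has_real_derivative b * max 0 s powr (b - 1)) (at s)"
proof -
  consider "s > 0" | "s < 0" | "s = 0" by linarith
  then show ?thesis
  proof cases
    case 1
    then have "((\<lambda>s. s powr b) has_real_derivative b * max 0 s powr (b - 1)) (at s)"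
      using has_real_derivative_powr[of s b] by simp
    then show ?thesis
      by (rule DERIV_cong_ev[THEN iffD1, rotated 3])
        (use 1 eventually_nhds_in_open[of "{0<..}" s] in \<open>auto elim!: eventually_mono\<close>)
  next
    case 2
    have "((\<lambda>s. 0) has_real_derivative b * max 0 s powr (b - 1)) (at s)" using 2 by simp
    then show ?thesis
      by (rule DERIV_cong_ev[THEN iffD1, rotated 3])
        (use 2 eventually_nhds_in_open[of "{..<0}" s] in \<open>auto elim!: eventually_mono\<close>)
  next
    \<comment> \<open>At the kink the difference quotient is at most
      \<open>max 0 h powr (b - 1)\<close>, which tends to 0 exactly because \<open>b > 1\<close>.
      The damping factor raises the exponent by 2 to secure this.\<close>
    case 3
    have "((\<lambda>h. max 0 h) \<longlongrightarrow> max 0 0) (at (0::real))"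
      by (intro tendsto_max tendsto_const tendsto_ident_at)
    then have "((\<lambda>h. max 0 h powr (b - 1)) \<longlongrightarrow> max 0 0 powr (b - 1)) (at (0::real))"
      by (rule tendsto_powr'[OF _ tendsto_const]) (use assms in auto)
    then have lim: "((\<lambda>h. max 0 h powr (b - 1)) \<longlongrightarrow> 0) (at (0::real))" using assms by simp
    have "((\<lambda>h. max 0 h powr b / h) \<longlongrightarrow> 0) (at (0::real))"
    proof (rule Lim_null_comparison[OF _ lim], rule always_eventually, rule allI)
      fix h :: real
      show "norm (max 0 h powr b / h) \<le> max 0 h powr (b - 1)"
        by (cases "h > 0") (auto simp: powr_diff)
    qed
    then show ?thesis using 3 assms by (simp add: DERIV_def)
  qed
qed

text \<open>The weight \<open>s\<^sup>a e\<^sup>-\<^sup>b\<^sup>s\<close> damped by \<open>s\<^sup>2 / (s\<^sup>2 + e)\<close>, which makes its extension by zero continuously differentiable.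
  The damping is chosen so that \<open>s\<close> times its logarithmic derivative, \<open>2 e / (s\<^sup>2 + e)\<close>, is bounded and
  vanishes in the limit \<open>e \<rightarrow> 0\<close>.\<close>
definition cutoff :: "real \<Rightarrow> real \<Rightarrow> real \<Rightarrow> real \<Rightarrow> real" where
  "cutoff a b e s = max 0 s powr (a + 2) * (exp (- b * s) / (s\<^sup>2 + e))"

definition cutoff' :: "real \<Rightarrow> real \<Rightarrow> real \<Rightarrow> real \<Rightarrow> real" where
  "cutoff' a b e s = (a + 2) * max 0 s powr (a + 1) * (exp (- b * s) / (s\<^sup>2 + e))
     + max 0 s powr (a + 2) * (exp (- b * s) / (s\<^sup>2 + e) * (- b - 2 * s / (s\<^sup>2 + e)))"

lemma sq_add_pos: "e > 0 \<Longrightarrow> 0 < s\<^sup>2 + (e::real)"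
  by (simp add: add_nonneg_pos)

lemma DERIV_cutoff:
  assumes "a \<ge> 0" "e > 0"
  shows "(cutoff a b e has_real_derivative cutoff' a b e s) (at s)"
proof -
  have p: "s\<^sup>2 + e \<noteq> 0" using sq_add_pos[OF assms(2), of s] by simp
  have 1: "((\<lambda>s. exp (- b * s) / (s\<^sup>2 + e)) has_real_derivative exp (- b * s) / (s\<^sup>2 + e) * (- b - 2 * s / (s\<^sup>2 + e))) (at s)"
    using p by (auto intro!: derivative_eq_intros simp: field_simps)
  have 2: "((\<lambda>s. max 0 s powr (a + 2)) has_real_derivative (a + 2) * max 0 s powr (a + 1)) (at s)"
    using DERIV_max_powr[of "a + 2" s] assms by (simp add: add.commute)
  show ?thesis unfolding cutoff_def cutoff'_def
    using DERIV_mult[OF 2 1] by (simp add: algebra_simps)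
qed

lemma continuous_on_cutoff':
  assumes "a \<ge> 0" "e > 0"
  shows "continuous_on UNIV (cutoff' a b e)"
  unfolding cutoff'_def using assms sq_add_pos[OF assms(2)]
  by (intro continuous_intros continuous_on_powr') (auto simp: less_imp_neq[symmetric])

lemma continuous_on_cutoff:
  assumes "a \<ge> 0" "e > 0"
  shows "continuous_on UNIV (cutoff a b e)"
  using DERIV_cutoff[OF assms] by (meson DERIV_isCont continuous_at_imp_continuous_on)

text \<open>The factor \<open>s\<close> absorbs the singular logarithmic derivative
  \<open>a / s\<close>, so the identity also holds for \<open>s \<le> 0\<close>, where both sides
  vanish. With \<open>a = N l_i(x)\<close> and \<open>b = N\<close> the bracket is
  \<open>N (l_i(x) - l_i(y))\<close> plus the damping error.\<close>

lemma cutoff_scaling: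
  assumes "e > 0"
  shows "s * cutoff' a b e s = cutoff a b e s * (a - b * s + 2 * e / (s\<^sup>2 + e))"
proof -
  define q where "q = exp (- b * s) / (s\<^sup>2 + e)"
  define P where "P = max 0 s powr (a + 2)"
  have "s * max 0 s powr (a + 1) = P"
  proof (cases "s > 0")
    case True
    then show ?thesis using powr_add[of s "a + 1" 1] by (simp add: P_def add.commute mult.commute)
  qed (simp add: P_def)
  then have "s * cutoff' a b e s = (a + 2) * P * q + P * (q * (- b * s - 2 * s\<^sup>2 / (s\<^sup>2 + e)))"
    unfolding cutoff'_def q_def[symmetric] P_def[symmetric] by (simp add: power2_eq_square algebra_simps)
  also have "2 * s\<^sup>2 / (s\<^sup>2 + e) = 2 - 2 * e / (s\<^sup>2 + e)"
    using sq_add_pos[OF assms, of s] by (simp add: field_simps)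
  finally show ?thesis unfolding cutoff_def q_def[symmetric] P_def[symmetric] by (simp add: algebra_simps)
qed

lemma cutoff_nonpos: "s \<le> 0 \<Longrightarrow> cutoff a b e s = 0"
  by (simp add: cutoff_def max_def)

lemma cutoff_pos: "s > 0 \<Longrightarrow> cutoff a b e s = pw s a * exp (- b * s) * (s\<^sup>2 / (s\<^sup>2 + e))"
  by (simp add: cutoff_def pw_def powr_add)

lemma cutoff_bounds:
  assumes "s > 0" "e > 0"
  shows "0 \<le> cutoff a b e s" "cutoff a b e s \<le> pw s a * exp (- b * s)"
proof -
  have p: "0 \<le> pw s a * exp (- b * s)" by (simp add: pw_def)
  have q: "0 \<le> s\<^sup>2 / (s\<^sup>2 + e)" "s\<^sup>2 / (s\<^sup>2 + e) \<le> 1"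
    using sq_add_pos[OF assms(2), of s] assms by auto
  show "0 \<le> cutoff a b e s" "cutoff a b e s \<le> pw s a * exp (- b * s)"
    unfolding cutoff_pos[OF assms(1)] by (rule mult_nonneg_nonneg[OF p q(1)], rule mult_left_le[OF q(2) p])
qed

text \<open>Positivity of \<open>s\<close> matters: for \<open>a = 0\<close> and
  \<open>s = 0\<close> the cutoff is always 0, whereas the limit weight is 1 by the convention for
  0^0.\<close>

lemma cutoff_tendsto:
  assumes "s > 0" "e \<longlonglongrightarrow> 0"
  shows "(\<lambda>n. cutoff a b (e n) s) \<longlonglongrightarrow> pw s a * exp (- b * s)"
proof -
  have "(\<lambda>n. pw s a * exp (- b * s) * (s\<^sup>2 / (s\<^sup>2 + e n))) \<longlonglongrightarrow> pw s a * exp (- b * s) * (s\<^sup>2 / (s\<^sup>2 + 0))"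
    using assms by (intro tendsto_intros) auto
  then show ?thesis using assms by (simp add: cutoff_pos)
qed

section \<open>The divergence identity on the polytope\<close>

lemma has_derivative_lat_dist:
  "(lat_dist u c i has_derivative (\<lambda>v. - (\<Sum>j\<in>UNIV. of_int (u i $ j) * v $ j))) (at y)"
  unfolding lat_dist_def
  by (auto intro!: derivative_eq_intros bounded_linear.has_derivative[OF bounded_linear_vec_nth])

text \<open>The neighbourhood \<open>V\<close> is a parameter because it is later shrunk to a convex
  one inside the domain of the test function, with \<open>G\<close> and \<open>W\<close>
  unchanged.\<close>

locale delzant_frame =
  fixes d :: nat and u :: "nat \<Rightarrow> int^'n::finite" and c :: "nat \<Rightarrow> int"
    and V :: "(real^'n) set" and G :: "'n \<Rightarrow> 'n \<Rightarrow> real^'n \<Rightarrow> real" and W :: "nat \<Rightarrow> 'n \<Rightarrow> real^'n \<Rightarrow> real"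
  assumes compact: "compact (poly_set d u c)" and interior: "interior (poly_set d u c) \<noteq> {}"
    and primitive: "\<And>i. i < d \<Longrightarrow> primitive_vec (u i)"
    and V: "open V" "poly_set d u c \<subseteq> V"
    and smooth_G: "\<And>k j. smooth_on_open V (G k j)" and smooth_W: "\<And>i j. i < d \<Longrightarrow> smooth_on_open V (W i j)"
    and u_G: "\<And>i j y. i < d \<Longrightarrow> y \<in> V \<Longrightarrow> (\<Sum>k\<in>UNIV. of_int (u i $ k) * G k j y) = lat_dist u c i y * W i j y"
    and u_W: "\<And>k j y. y \<in> V \<Longrightarrow> (\<Sum>i<d. of_int (u i $ k) * W i j y) = (if k = j then 1 else 0)"
begin

abbreviation "\<Delta> \<equiv> poly_set d u c"
abbreviation "lat \<equiv> lat_dist u c"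

definition cut :: "nat \<Rightarrow> real^'n \<Rightarrow> real \<Rightarrow> real^'n \<Rightarrow> real" where
  "cut N x e y = (\<Prod>i<d. cutoff (real N * lat i x) (real N) e (lat i y))"

text \<open>The partial derivative of \<open>cut\<close> in direction \<open>k\<close>; the minus
  sign arises since the gradient of \<open>lat i\<close> is the negative of
  \<open>u i\<close>.\<close>

definition cut' :: "nat \<Rightarrow> real^'n \<Rightarrow> real \<Rightarrow> 'n \<Rightarrow> real^'n \<Rightarrow> real" where
  "cut' N x e k y = - (\<Sum>i<d. of_int (u i $ k) * cutoff' (real N * lat i x) (real N) e (lat i y)
     * (\<Prod>l\<in>{..<d} - {i}. cutoff (real N * lat l x) (real N) e (lat l y)))"

lemma lat_nonneg: "x \<in> \<Delta> \<Longrightarrow> i < d \<Longrightarrow> 0 \<le> lat i x"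
  by (simp add: poly_set_def)

lemma cut_outside: "y \<notin> \<Delta> \<Longrightarrow> cut N x e y = 0"
  unfolding cut_def by (auto simp: poly_set_def not_le intro!: prod_zero cutoff_nonpos less_imp_le)

lemma cut_derivative:
  assumes "x \<in> \<Delta>" "e > 0"
  shows "cut N x e differentiable (at y)" "dpart k (cut N x e) y = cut' N x e k y"
proof -
  let ?a = "\<lambda>i. real N * lat i x"
  have "((\<lambda>y. cutoff (?a i) (real N) e (lat i y)) has_derivative
      (\<lambda>v. - (\<Sum>j\<in>UNIV. of_int (u i $ j) * v $ j) * cutoff' (?a i) (real N) e (lat i y))) (at y)" if "i < d" for i
    by (rule DERIV_compose_FDERIV[OF DERIV_cutoff has_derivative_lat_dist]) (use assms lat_nonneg that in auto)
  then have D: "(cut N x e has_derivative (\<lambda>v. \<Sum>i<d. (- (\<Sum>j\<in>UNIV. of_int (u i $ j) * v $ j) * cutoff' (?a i) (real N) e (lat i y))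
      * (\<Prod>l\<in>{..<d} - {i}. cutoff (?a l) (real N) e (lat l y)))) (at y)"
    unfolding cut_def[abs_def] by (intro has_derivative_prod) auto
  then show "cut N x e differentiable (at y)" by (rule differentiableI)
  show "dpart k (cut N x e) y = cut' N x e k y"
    unfolding dpart_eq[OF D] cut'_def
    by (simp add: axis_def if_distrib[of "\<lambda>z. _ * z"] sum_negf cong: if_cong)
qed

lemma continuous_on_lat_comp: "continuous_on UNIV f \<Longrightarrow> continuous_on S (\<lambda>y. f (lat i y))" for f :: "real \<Rightarrow> real"
  by (rule continuous_on_compose2[OF _ continuous_on_lat_dist]) auto

lemma continuous_on_cut: "x \<in> \<Delta> \<Longrightarrow> e > 0 \<Longrightarrow> continuous_on S (cut N x e)"
  unfolding cut_def by (intro continuous_intros continuous_on_lat_comp continuous_on_cutoff) (auto simp: lat_nonneg)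

lemma continuous_on_cut': "x \<in> \<Delta> \<Longrightarrow> e > 0 \<Longrightarrow> continuous_on S (cut' N x e k)"
  unfolding cut'_def
  by (intro continuous_intros continuous_on_lat_comp continuous_on_cutoff continuous_on_cutoff') (auto simp: lat_nonneg)

text \<open>Damped form of <grad E_N, G_j> = - N (y - x)_j E_N. By \<open>u_G\<close> the
  \<open>i\<close>-th summand carries the factor \<open>lat i y\<close> that
  \<open>cutoff_scaling\<close> needs, so nothing singular appears at the facets. The terms with
  \<open>2 * e\<close> are the damping error.\<close>

lemma cut'_G:
  assumes "y \<in> \<Delta>" "e > 0"
  shows "(\<Sum>k\<in>UNIV. cut' N x e k y * G k j y) =
    - cut N x e y * (real N * (y $ j - x $ j) + (\<Sum>i<d. W i j y * (2 * e / ((lat i y)\<^sup>2 + e))))"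
proof -
  let ?a = "\<lambda>i. real N * lat i x"
  let ?P = "\<lambda>i. \<Prod>l\<in>{..<d} - {i}. cutoff (?a l) (real N) e (lat l y)"
  have y: "y \<in> V" using assms V by blast
  have "(\<Sum>k\<in>UNIV. cut' N x e k y * G k j y) =
      - (\<Sum>k\<in>UNIV. \<Sum>i<d. cutoff' (?a i) (real N) e (lat i y) * ?P i * (of_int (u i $ k) * G k j y))"
    unfolding cut'_def
    by (simp only: sum_distrib_left sum_distrib_right sum_negf mult_minus_left mult_minus_right mult_ac)
  also have "\<dots> = - (\<Sum>i<d. cutoff' (?a i) (real N) e (lat i y) * ?P i * (\<Sum>k\<in>UNIV. of_int (u i $ k) * G k j y))"
    by (subst sum.swap) (simp add: sum_distrib_left)
  also have "\<dots> = - (\<Sum>i<d. W i j y * (lat i y * cutoff' (?a i) (real N) e (lat i y)) * ?P i)"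
  proof (intro arg_cong[where f = uminus] sum.cong refl)
    fix i assume "i \<in> {..<d}"
    then have "(\<Sum>k\<in>UNIV. of_int (u i $ k) * G k j y) = lat i y * W i j y" using u_G y by blast
    then show "cutoff' (?a i) (real N) e (lat i y) * ?P i * (\<Sum>k\<in>UNIV. of_int (u i $ k) * G k j y) =
        W i j y * (lat i y * cutoff' (?a i) (real N) e (lat i y)) * ?P i" by simp
  qed
  also have "\<dots> = - (\<Sum>i<d. cut N x e y * (W i j y * (real N * (lat i x - lat i y) + 2 * e / ((lat i y)\<^sup>2 + e))))"
  proof (intro arg_cong[where f = uminus] sum.cong refl)
    fix i assume "i \<in> {..<d}"
    then have "cut N x e y = cutoff (?a i) (real N) e (lat i y) * ?P i"
      unfolding cut_def by (subst prod.remove[of _ i]) auto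
    then show "W i j y * (lat i y * cutoff' (?a i) (real N) e (lat i y)) * ?P i =
        cut N x e y * (W i j y * (real N * (lat i x - lat i y) + 2 * e / ((lat i y)\<^sup>2 + e)))"
      unfolding cutoff_scaling[OF assms(2)] by (simp add: algebra_simps)
  qed
  also have "\<dots> = - cut N x e y * (real N * (\<Sum>i<d. W i j y * (lat i x - lat i y)) + (\<Sum>i<d. W i j y * (2 * e / ((lat i y)\<^sup>2 + e))))"
    by (simp add: sum_distrib_left[symmetric] distrib_left sum.distrib) (simp add: sum_distrib_left mult_ac)
  \<comment> \<open>The differences of lattice distances are pairings of \<open>u i\<close> with y -
    x, so \<open>u_W\<close> selects the coordinate \<open>j\<close>.\<close>
  also have "(\<Sum>i<d. W i j y * (lat i x - lat i y)) = (\<Sum>k\<in>UNIV. (y $ k - x $ k) * (\<Sum>i<d. of_int (u i $ k) * W i j y))"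
    unfolding lat_dist_diff sum_distrib_left by (subst sum.swap) (simp add: mult_ac)
  also have "\<dots> = y $ j - x $ j" using y by (simp add: u_W if_distrib[of "\<lambda>z. _ * z"] cong: if_cong)
  finally show ?thesis .
qed


text \<open>The integrand is the divergence of the damped weight times \<open>f\<close> times column
  \<open>j\<close> of \<open>G\<close>, extended by zero. Each component has bounded support and
  bounded partials, so its derivatives integrate to zero.\<close>

lemma cut_identity:
  assumes x: "x \<in> \<Delta>" and e: "e > 0" and f: "smooth_on_open V f"
  shows "(\<integral>y. indicator \<Delta> y *\<^sub>R (cut N x e y * ((\<Sum>k\<in>UNIV. dpart k (\<lambda>z. G k j z * f z) y)
      - real N * (y $ j - x $ j) * f y - f y * (\<Sum>i<d. W i j y * (2 * e / ((lat i y)\<^sup>2 + e))))) \<partial>lborel) = 0"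
proof -
  define p where "p = (\<lambda>k z. G k j z * f z)"
  define h where "h = (\<lambda>k y. if y \<in> \<Delta> then cut N x e y * p k y else 0)"
  have p: "smooth_on_open V (p k)" for k unfolding p_def by (intro smooth_on_open_mult smooth_G f)
  have hV: "h k y = cut N x e y * p k y" if "y \<in> V" for k y using cut_outside by (auto simp: h_def)
  have op: "open (- \<Delta>)" using compact by (simp add: compact_imp_closed open_Compl)
  \<comment> \<open>Differentiability is local, and two open sets cover the space: on
    \<open>V\<close> the function is the product, because \<open>cut\<close> vanishes off the
    polytope, and on the complement of the polytope it is zero.\<close>
  have h: "h k differentiable (at y) \<and> dpart l (h k) y =
      (if y \<in> \<Delta> then cut N x e y * dpart l (p k) y + cut' N x e l y * p k y else 0)" for k l y
  proof (cases "y \<in> \<Delta>")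
    case True
    then have y: "y \<in> V" using V by blast
    have d: "cut N x e differentiable (at y)" "p k differentiable (at y)"
      using cut_derivative[OF x e] smooth_on_openD[OF p y] by auto
    have "dpart l (h k) y = dpart l (\<lambda>y. cut N x e y * p k y) y"
      by (rule dpart_cong_open[OF V(1) y hV])
    moreover have "h k differentiable (at y)"
      using differentiable_mult[OF d] has_derivative_cong_open[OF V(1) y, of "h k" "\<lambda>y. cut N x e y * p k y"] hV
      unfolding differentiable_def by blast
    ultimately show ?thesis using True by (simp add: dpart_mult[OF d] cut_derivative[OF x e])
  next
    case False
    have 0: "(h k has_derivative (\<lambda>v. 0)) (at y)"
      by (subst has_derivative_cong_open[OF op, of y "h k" "\<lambda>_. 0"]) (use False in \<open>auto simp: h_def\<close>)
    then show ?thesis using False dpart_eq[OF 0] by (auto intro: differentiableI)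
  qed
  have bd: "\<exists>C. \<forall>l y. \<bar>dpart l (h k) y\<bar> \<le> C" for k
  proof -
    have "\<exists>B. \<forall>y. \<bar>dpart l (h k) y\<bar> \<le> B" for l
    proof -
      have "continuous_on \<Delta> (\<lambda>y. cut N x e y * dpart l (p k) y + cut' N x e l y * p k y)"
        by (intro continuous_intros continuous_on_cut continuous_on_cut' x e)
          (use p V smooth_on_open_dpart smooth_on_open_continuous_on continuous_on_subset in blast)+
      then have "bounded ((\<lambda>y. cut N x e y * dpart l (p k) y + cut' N x e l y * p k y) ` \<Delta>)"
        by (intro compact_imp_bounded compact_continuous_image compact)
      then obtain B where "\<And>y. y \<in> \<Delta> \<Longrightarrow> \<bar>cut N x e y * dpart l (p k) y + cut' N x e l y * p k y\<bar> \<le> B"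
        unfolding bounded_iff by auto
      then show ?thesis using h by (intro exI[of _ "max 0 B"]) (auto simp: le_max_iff_disj)
    qed
    then obtain B where B: "\<And>l y. \<bar>dpart l (h k) y\<bar> \<le> B l" by metis
    have "\<bar>dpart l (h k) y\<bar> \<le> (\<Sum>l\<in>UNIV. \<bar>B l\<bar>)" for l y
      using B[of l y] member_le_sum[of l UNIV "\<lambda>l. \<bar>B l\<bar>"] by force
    then show ?thesis by blast
  qed
  have int: "integrable lborel (dpart k (h k))" "(\<integral>y. dpart k (h k) y \<partial>lborel) = 0" for k
  proof -
    obtain C where C: "\<And>l y. \<bar>dpart l (h k) y\<bar> \<le> C" using bd by blast
    have df: "h k differentiable (at y)" for y using h by blast
    have z: "h k y = 0" if "y \<notin> \<Delta>" for y using that by (simp add: h_def)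
    show "integrable lborel (dpart k (h k))" "(\<integral>y. dpart k (h k) y \<partial>lborel) = 0"
      using integral_dpart_eq_0[OF df C compact_imp_bounded[OF compact] z] by blast+
  qed
  have "(\<Sum>k\<in>UNIV. dpart k (h k) y) = indicator \<Delta> y *\<^sub>R (cut N x e y * ((\<Sum>k\<in>UNIV. dpart k (p k) y)
      - real N * (y $ j - x $ j) * f y - f y * (\<Sum>i<d. W i j y * (2 * e / ((lat i y)\<^sup>2 + e)))))" for y
  proof (cases "y \<in> \<Delta>")
    case True
    then have "(\<Sum>k\<in>UNIV. dpart k (h k) y) = (\<Sum>k\<in>UNIV. cut N x e y * dpart k (p k) y + cut' N x e k y * G k j y * f y)"
      using h by (simp add: p_def mult.assoc)
    also have "\<dots> = cut N x e y * (\<Sum>k\<in>UNIV. dpart k (p k) y) + (\<Sum>k\<in>UNIV. cut' N x e k y * G k j y) * f y"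
      by (simp add: sum.distrib sum_distrib_left sum_distrib_right)
    finally show ?thesis unfolding cut'_G[OF True e] using True by (simp add: algebra_simps)
  qed (simp add: h)
  then have "(\<integral>y. indicator \<Delta> y *\<^sub>R (cut N x e y * ((\<Sum>k\<in>UNIV. dpart k (p k) y)
      - real N * (y $ j - x $ j) * f y - f y * (\<Sum>i<d. W i j y * (2 * e / ((lat i y)\<^sup>2 + e))))) \<partial>lborel)
      = (\<integral>y. (\<Sum>k\<in>UNIV. dpart k (h k) y) \<partial>lborel)" by presburger
  also have "\<dots> = 0" using int by (subst Bochner_Integration.integral_sum) auto
  finally show ?thesis by (simp add: p_def)
qed

text \<open>The exponents depend on \<open>x\<close> only. Each is either 0, making the power
  constantly 1, or positive, making it continuous up to the facet.\<close>

lemma continuous_on_EN: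
  assumes "x \<in> \<Delta>"
  shows "continuous_on \<Delta> (EN d u c N x)"
  unfolding EN_def
proof (intro continuous_intros continuous_on_lat_dist)
  fix i assume "i \<in> {..<d}"
  then have "0 \<le> lat i x" "\<forall>y\<in>\<Delta>. 0 \<le> lat i y" using lat_nonneg assms by auto
  then show "continuous_on \<Delta> (\<lambda>y. pw (lat i y) (real N * lat i x))"
    unfolding pw_def by (cases "real N * lat i x = 0")
      (auto intro!: continuous_on_powr' continuous_on_lat_dist continuous_on_const)
qed

lemma EN_nonneg: "0 \<le> EN d u c N x y"
  unfolding EN_def pw_def by (intro prod_nonneg) auto

text \<open>The limit \<open>e \<rightarrow> 0\<close> of \<open>cut_identity\<close> by dominated
  convergence. No boundary term survives, also when \<open>x\<close> lies on a facet.\<close>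

lemma integration_by_parts:
  assumes x: "x \<in> \<Delta>" and f: "smooth_on_open V f"
  shows "(LINT y:\<Delta>|lborel. EN d u c N x y * (real N * (y $ j - x $ j) * f y)) =
    (LINT y:\<Delta>|lborel. EN d u c N x y * (\<Sum>k\<in>UNIV. dpart k (\<lambda>z. G k j z * f z) y))"
proof -
  define P where "P = (\<lambda>y. \<Sum>k\<in>UNIV. dpart k (\<lambda>z. G k j z * f z) y)"
  define Q where "Q = (\<lambda>y. real N * (y $ j - x $ j) * f y)"
  define e where "e = (\<lambda>n. inverse (real (Suc n)))"
  define R where "R = (\<lambda>n y. f y * (\<Sum>i<d. W i j y * (2 * e n / ((lat i y)\<^sup>2 + e n))))"
  define F where "F = (\<lambda>n y. indicator \<Delta> y *\<^sub>R (cut N x (e n) y * (P y - Q y - R n y)))"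
  have e: "0 < e n" for n by (simp add: e_def)
  have e0: "e \<longlonglongrightarrow> 0" unfolding e_def by (rule LIMSEQ_inverse_real_of_nat)
  have cf: "continuous_on \<Delta> f" using f V smooth_on_open_continuous_on continuous_on_subset by blast
  have cP: "continuous_on \<Delta> P"
    unfolding P_def by (rule continuous_on_subset[OF smooth_on_open_continuous_on V(2)])
      (intro smooth_on_open_sum V smooth_on_open_dpart smooth_on_open_mult smooth_G f)
  have cQ: "continuous_on \<Delta> Q" unfolding Q_def by (intro continuous_intros cf)
  have cW: "continuous_on \<Delta> (W i j)" if "i < d" for i
    using smooth_W[OF that] V smooth_on_open_continuous_on continuous_on_subset by blast
  have cR: "continuous_on \<Delta> (R n)" for n
    unfolding R_def using sq_add_pos[OF e]
    by (intro continuous_intros cf cW continuous_on_lat_dist) (auto simp: less_imp_neq[symmetric])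
  have [measurable]: "\<Delta> \<in> sets borel" using compact by (simp add: borel_compact)
  have "F n \<in> borel_measurable borel" for n
    unfolding F_def
    by (intro borel_measurable_continuous_on_indicator continuous_intros continuous_on_cut cP cQ cR x e) simp
  then have Fm: "F n \<in> borel_measurable lborel" for n by simp
  \<comment> \<open>Dominates uniformly in \<open>n\<close>: \<open>cut\<close> is at most
    \<open>EN\<close>, and \<open>2 * e / (s\<^sup>2 + e)\<close> is at most 2.\<close>
  define w where "w = (\<lambda>y. indicator \<Delta> y *\<^sub>R (EN d u c N x y * (\<bar>P y\<bar> + \<bar>Q y\<bar> + \<bar>f y\<bar> * (\<Sum>i<d. \<bar>W i j y\<bar> * 2))))"
  have w: "integrable lborel w"
    unfolding w_def by (intro borel_integrable_compact compact continuous_intros continuous_on_EN x cP cQ cf cW) auto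
  have iP: "integrable lborel (\<lambda>y. indicator \<Delta> y *\<^sub>R (EN d u c N x y * P y))"
    and iQ: "integrable lborel (\<lambda>y. indicator \<Delta> y *\<^sub>R (EN d u c N x y * Q y))"
    by (intro borel_integrable_compact compact continuous_intros continuous_on_EN x cP cQ)+
  have AE: "AE y in lborel. y \<in> \<Delta> \<longrightarrow> (\<forall>i<d. 0 < lat i y)"
    by (rule AE_lat_dist_pos) (use primitive in auto)
  \<comment> \<open>On a facet one damping quotient stays at 2 and \<open>cut\<close> stays at 0, so
    the limit can only be claimed almost everywhere.\<close>
  have lim: "AE y in lborel. (\<lambda>n. F n y) \<longlonglongrightarrow> indicator \<Delta> y *\<^sub>R (EN d u c N x y * (P y - Q y))"
    using AE
  proof eventually_elim
    case (elim y)
    show ?case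
    proof (cases "y \<in> \<Delta>")
      case True
      then have pos: "\<And>i. i < d \<Longrightarrow> 0 < lat i y" using elim by blast
      have 1: "(\<lambda>n. cut N x (e n) y) \<longlonglongrightarrow> EN d u c N x y"
        unfolding cut_def EN_def using pos by (intro tendsto_prod cutoff_tendsto e0) auto
      have t: "(\<lambda>n. W i j y * (2 * e n / ((lat i y)\<^sup>2 + e n))) \<longlonglongrightarrow> W i j y * (2 * 0 / ((lat i y)\<^sup>2 + 0))" if "i < d" for i
        using pos[OF that] by (intro tendsto_intros e0) auto
      have "(\<lambda>n. R n y) \<longlonglongrightarrow> f y * (\<Sum>i<d. W i j y * (2 * 0 / ((lat i y)\<^sup>2 + 0)))"
        unfolding R_def by (rule tendsto_mult[OF tendsto_const], rule tendsto_sum, rule t) simp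
      then have 2: "(\<lambda>n. R n y) \<longlonglongrightarrow> 0" by simp
      have "(\<lambda>n. cut N x (e n) y * (P y - Q y - R n y)) \<longlonglongrightarrow> EN d u c N x y * (P y - Q y - 0)"
        by (intro tendsto_intros 1 2)
      then show ?thesis using True by (simp add: F_def)
    qed (simp add: F_def)
  qed
  have bnd: "AE y in lborel. norm (F n y) \<le> w y" for n
    using AE
  proof eventually_elim
    case (elim y)
    show ?case
    proof (cases "y \<in> \<Delta>")
      case True
      then have pos: "\<And>i. i < d \<Longrightarrow> 0 < lat i y" using elim by blast
      have 1: "0 \<le> cut N x (e n) y" "cut N x (e n) y \<le> EN d u c N x y"
        unfolding cut_def EN_def
        by (intro prod_nonneg cutoff_bounds pos e, simp) (intro prod_mono conjI cutoff_bounds pos e; simp)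
      have r: "\<bar>2 * e n / ((lat i y)\<^sup>2 + e n)\<bar> \<le> 2" for i
        using e[of n] sq_add_pos[OF e, of "lat i y" n] by (simp add: abs_of_pos field_simps)
      have "\<bar>\<Sum>i<d. W i j y * (2 * e n / ((lat i y)\<^sup>2 + e n))\<bar> \<le> (\<Sum>i<d. \<bar>W i j y\<bar> * 2)"
        by (intro order_trans[OF sum_abs] sum_mono, subst abs_mult, rule mult_left_mono[OF r abs_ge_zero])
      then have "\<bar>R n y\<bar> \<le> \<bar>f y\<bar> * (\<Sum>i<d. \<bar>W i j y\<bar> * 2)"
        unfolding R_def abs_mult by (intro mult_left_mono) auto
      then have "\<bar>P y - Q y - R n y\<bar> \<le> \<bar>P y\<bar> + \<bar>Q y\<bar> + \<bar>f y\<bar> * (\<Sum>i<d. \<bar>W i j y\<bar> * 2)" by linarith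
      then have "cut N x (e n) y * \<bar>P y - Q y - R n y\<bar> \<le> EN d u c N x y * (\<bar>P y\<bar> + \<bar>Q y\<bar> + \<bar>f y\<bar> * (\<Sum>i<d. \<bar>W i j y\<bar> * 2))"
        using 1 by (intro mult_mono) auto
      then show ?thesis using True 1 by (simp add: F_def w_def abs_mult)
    qed (simp add: F_def w_def)
  qed
  have lm: "(\<lambda>n. \<integral>y. F n y \<partial>lborel) \<longlonglongrightarrow> (\<integral>y. indicator \<Delta> y *\<^sub>R (EN d u c N x y * (P y - Q y)) \<partial>lborel)"
    by (rule integral_dominated_convergence[OF _ Fm w lim bnd])
      (use borel_measurable_integrable[OF Bochner_Integration.integrable_diff[OF iP iQ]] in \<open>simp add: algebra_simps\<close>)
  have z: "(\<integral>y. F n y \<partial>lborel) = 0" for n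
    using cut_identity[OF x e f, of N n j] unfolding F_def P_def Q_def R_def .
  have "0 = (\<integral>y. indicator \<Delta> y *\<^sub>R (EN d u c N x y * (P y - Q y)) \<partial>lborel)"
    using lm unfolding z LIMSEQ_const_iff .
  then have "(\<integral>y. indicator \<Delta> y *\<^sub>R (EN d u c N x y * P y) - indicator \<Delta> y *\<^sub>R (EN d u c N x y * Q y) \<partial>lborel) = 0"
    by (simp add: right_diff_distrib)
  then show ?thesis
    using Bochner_Integration.integral_diff[OF iP iQ] unfolding set_lebesgue_integral_def P_def Q_def by simp
qed

lemma not_AE_outside: "\<not> (AE y in lborel. y \<notin> \<Delta>)"
proof
  assume "AE y in lborel. y \<notin> \<Delta>"
  then have "AE y in lborel. y \<notin> interior \<Delta>" by eventually_elim (use interior_subset in blast)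
  then have "interior \<Delta> \<in> null_sets lborel" by (subst (asm) AE_iff_null) auto
  then have "negligible (interior \<Delta>)" by (simp add: negligible_iff_null_sets null_sets_completionI)
  then show False using open_not_negligible[OF open_interior] interior by blast
qed

text \<open>The integrand is positive off the facets, so a vanishing integral would make the
  polytope a null set, against its nonempty interior.\<close>

lemma cN_pos:
  assumes x: "x \<in> \<Delta>"
  shows "0 < cN d u c N x"
proof -
  have int: "integrable lborel (\<lambda>y. indicator \<Delta> y *\<^sub>R EN d u c N x y)"
    by (intro borel_integrable_compact compact continuous_on_EN x)
  have nn: "AE y in lborel. 0 \<le> indicator \<Delta> y *\<^sub>R EN d u c N x y" by (simp add: EN_nonneg)
  have "(\<integral>y. indicator \<Delta> y *\<^sub>R EN d u c N x y \<partial>lborel) \<noteq> 0"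
  proof
    assume "(\<integral>y. indicator \<Delta> y *\<^sub>R EN d u c N x y \<partial>lborel) = 0"
    then have "AE y in lborel. indicator \<Delta> y *\<^sub>R EN d u c N x y = 0"
      using integral_nonneg_eq_0_iff_AE[OF int nn] by simp
    moreover have "AE y in lborel. y \<in> \<Delta> \<longrightarrow> (\<forall>i<d. 0 < lat i y)"
      by (rule AE_lat_dist_pos) (use primitive in auto)
    ultimately have "AE y in lborel. y \<notin> \<Delta>"
    proof eventually_elim
      case (elim y)
      show ?case
      proof
        assume "y \<in> \<Delta>"
        then have "EN d u c N x y > 0" unfolding EN_def pw_def using elim by (intro prod_pos) auto
        then show False using elim \<open>y \<in> \<Delta>\<close> by simp
      qed
    qed
    then show False using not_AE_outside by blast
  qed
  moreover have "0 \<le> (\<integral>y. indicator \<Delta> y *\<^sub>R EN d u c N x y \<partial>lborel)"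
    by (rule integral_nonneg_AE[OF nn])
  ultimately show ?thesis unfolding cN_def set_lebesgue_integral_def by simp
qed

end

section \<open>The differential operators\<close>

lemma finite_lists_le: "finite {js :: 'n::finite list. length js \<le> m}"
  using finite_lists_length_le[of "UNIV :: 'n set" m] by simp

lemma finite_lists_eq: "finite {js :: 'n::finite list. length js = m}"
  using finite_lists_length_eq[of "UNIV :: 'n set" m] by simp

lemma sum_lists_append:
  fixes F :: "'n::finite list \<Rightarrow> real"
  assumes "finite A"
  shows "(\<Sum>js\<in>(\<lambda>(\<gamma>, j). \<gamma> @ [j]) ` (A \<times> UNIV). F js) = (\<Sum>j\<in>UNIV. \<Sum>\<gamma>\<in>A. F (\<gamma> @ [j]))"
proof -
  have "(\<Sum>js\<in>(\<lambda>(\<gamma>, j). \<gamma> @ [j]) ` (A \<times> UNIV). F js) = (\<Sum>(\<gamma>, j)\<in>A \<times> UNIV. F (\<gamma> @ [j]))"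
    by (subst sum.reindex) (auto simp: inj_on_def split_def)
  also have "\<dots> = (\<Sum>\<gamma>\<in>A. \<Sum>j\<in>UNIV. F (\<gamma> @ [j]))"
    using assms by (simp add: sum.cartesian_product)
  finally show ?thesis by (simp add: sum.swap[of _ UNIV A])
qed

text \<open>The last entry is split off because it is the innermost derivative in
  \<open>iter_part\<close>, and Hadamard's lemma differentiates f first.\<close>

lemma sum_lists_length_Suc_le:
  fixes F :: "'n::finite list \<Rightarrow> real"
  shows "(\<Sum>js | length js \<le> Suc m. F js) = F [] + (\<Sum>j\<in>UNIV. \<Sum>\<gamma> | length \<gamma> \<le> m. F (\<gamma> @ [j]))"
proof -
  let ?A = "(\<lambda>(\<gamma>, j). \<gamma> @ [j]) ` ({\<gamma> :: 'n list. length \<gamma> \<le> m} \<times> UNIV)"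
  have "js \<in> insert [] ?A" if "length js \<le> Suc m" for js :: "'n list"
    using that by (cases js rule: rev_cases) (auto simp: image_iff)
  then have "{js :: 'n list. length js \<le> Suc m} = insert [] ?A" by auto
  moreover have "finite ?A" by (simp add: finite_lists_le)
  moreover have "[] \<notin> ?A" by auto
  ultimately show ?thesis using sum_lists_append[OF finite_lists_le, of F m] by simp
qed

lemma sum_lists_length_Suc_eq:
  fixes F :: "'n::finite list \<Rightarrow> real"
  shows "(\<Sum>js | length js = Suc m. F js) = (\<Sum>j\<in>UNIV. \<Sum>\<gamma> | length \<gamma> = m. F (\<gamma> @ [j]))"
proof -
  let ?A = "(\<lambda>(\<gamma>, j). \<gamma> @ [j]) ` ({\<gamma> :: 'n list. length \<gamma> = m} \<times> UNIV)"
  have "js \<in> ?A" if "length js = Suc m" for js :: "'n list"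
    using that by (cases js rule: rev_cases) (auto simp: image_iff)
  then have "{js :: 'n list. length js = Suc m} = ?A" by auto
  then show ?thesis using sum_lists_append[OF finite_lists_eq, of F m] by auto
qed

text \<open>The coefficient of the derivative \<open>\<gamma>\<close> of h in the derivative
  \<open>\<beta>\<close> of a h. By the product rule an outer derivative \<open>k\<close> either
  hits the coefficient or is put in front of \<open>\<gamma>\<close>.\<close>

fun leibniz_coeff :: "(real^'n::finite \<Rightarrow> real) \<Rightarrow> 'n list \<Rightarrow> 'n list \<Rightarrow> real^'n \<Rightarrow> real" where
  "leibniz_coeff a [] \<gamma> = (\<lambda>x. if \<gamma> = [] then a x else 0)"
| "leibniz_coeff a (k # \<beta>) \<gamma> = (\<lambda>x. dpart k (leibniz_coeff a \<beta> \<gamma>) x +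
     (case \<gamma> of [] \<Rightarrow> 0 | l # \<gamma>' \<Rightarrow> if l = k then leibniz_coeff a \<beta> \<gamma>' x else 0))"

lemma dpart_const: "dpart j (\<lambda>x. r) x = 0"
  by (rule dpart_eq[where D = "\<lambda>_. 0"]) auto

lemma smooth_leibniz_coeff:
  assumes "smooth_on_open V a"
  shows "smooth_on_open V (leibniz_coeff a \<beta> \<gamma>)"
proof (induction \<beta> arbitrary: \<gamma>)
  case Nil
  have "open V" using assms smooth_on_open_def by blast
  then show ?case using assms smooth_on_open_const by (cases \<gamma>) simp_all
next
  case (Cons k \<beta>)
  show ?case
  proof (cases \<gamma>)
    case Nil
    then show ?thesis using smooth_on_open_dpart[OF Cons.IH] by simp
  next
    case (Cons l \<gamma>')
    then show ?thesis using smooth_on_open_dpart[OF Cons.IH] smooth_on_open_add[OF smooth_on_open_dpart[OF Cons.IH] Cons.IH]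
      by (cases "l = k") auto
  qed
qed

lemma leibniz_coeff_zero: "length \<gamma> > length \<beta> \<Longrightarrow> leibniz_coeff a \<beta> \<gamma> = (\<lambda>_. 0)"
proof (induction \<beta> arbitrary: \<gamma>)
  case (Cons k \<beta>)
  then show ?case by (cases \<gamma>) (auto simp: dpart_const)
qed auto

text \<open>At full length every derivative has fallen on the second factor. Only these terms enter
  the principal symbol.\<close>

lemma leibniz_coeff_top: "length \<gamma> = length \<beta> \<Longrightarrow> leibniz_coeff a \<beta> \<gamma> x = (if \<gamma> = \<beta> then a x else 0)"
proof (induction \<beta> arbitrary: \<gamma>)
  case (Cons k \<beta>)
  then obtain l \<gamma>' where "\<gamma> = l # \<gamma>'" by (cases \<gamma>) auto
  then show ?case using Cons by (auto simp: leibniz_coeff_zero dpart_const)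
qed auto

lemma iter_part_mult:
  assumes a: "smooth_on_open V a" and h: "smooth_on_open V h"
  shows "x \<in> V \<Longrightarrow> iter_part \<beta> (\<lambda>z. a z * h z) x = (\<Sum>\<gamma> | length \<gamma> \<le> length \<beta>. leibniz_coeff a \<beta> \<gamma> x * iter_part \<gamma> h x)"
proof (induction \<beta> arbitrary: x)
  case Nil
  have "{\<gamma>. length \<gamma> \<le> length []} = {[] :: 'a list}" by auto
  then show ?case by simp
next
  case (Cons k \<beta>)
  let ?L = "{\<gamma> :: 'a list. length \<gamma> \<le> length \<beta>}" and ?L' = "{\<gamma> :: 'a list. length \<gamma> \<le> length (k # \<beta>)}"
  have o: "open V" using a smooth_on_open_def by blast
  have d: "leibniz_coeff a \<beta> \<gamma> differentiable (at x)" "iter_part \<gamma> h differentiable (at x)" for \<gamma>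
    using smooth_on_openD Cons.prems smooth_leibniz_coeff[OF a] smooth_on_open_iter_part[OF h] by blast+
  have "iter_part (k # \<beta>) (\<lambda>z. a z * h z) x = dpart k (\<lambda>x. \<Sum>\<gamma>\<in>?L. leibniz_coeff a \<beta> \<gamma> x * iter_part \<gamma> h x) x"
    using dpart_cong_open[OF o Cons.prems Cons.IH] by simp
  also have "\<dots> = (\<Sum>\<gamma>\<in>?L. dpart k (\<lambda>x. leibniz_coeff a \<beta> \<gamma> x * iter_part \<gamma> h x) x)"
    by (intro dpart_sum finite_lists_le differentiable_mult d)
  also have "\<dots> = (\<Sum>\<gamma>\<in>?L. leibniz_coeff a \<beta> \<gamma> x * iter_part (k # \<gamma>) h x) + (\<Sum>\<gamma>\<in>?L. dpart k (leibniz_coeff a \<beta> \<gamma>) x * iter_part \<gamma> h x)"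
    by (simp add: dpart_mult[OF d] sum.distrib)
  \<comment> \<open>Vanishing top coefficients pad the sum, so that both parts run over the same
    lists.\<close>
  also have "(\<Sum>\<gamma>\<in>?L. dpart k (leibniz_coeff a \<beta> \<gamma>) x * iter_part \<gamma> h x) = (\<Sum>\<gamma>\<in>?L'. dpart k (leibniz_coeff a \<beta> \<gamma>) x * iter_part \<gamma> h x)"
    by (rule sum.mono_neutral_left) (auto simp: leibniz_coeff_zero dpart_const not_le intro: finite_lists_le[of "Suc _", simplified])
  also have "(\<Sum>\<gamma>\<in>?L. leibniz_coeff a \<beta> \<gamma> x * iter_part (k # \<gamma>) h x) =
      (\<Sum>\<gamma>\<in>(#) k ` ?L. (case \<gamma> of [] \<Rightarrow> 0 | l # \<gamma>' \<Rightarrow> if l = k then leibniz_coeff a \<beta> \<gamma>' x else 0) * iter_part \<gamma> h x)"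
    by (subst sum.reindex) auto
  also have "\<dots> = (\<Sum>\<gamma>\<in>?L'. (case \<gamma> of [] \<Rightarrow> 0 | l # \<gamma>' \<Rightarrow> if l = k then leibniz_coeff a \<beta> \<gamma>' x else 0) * iter_part \<gamma> h x)"
    by (rule sum.mono_neutral_left) (auto simp: finite_lists_le image_iff split: list.splits)
  finally show ?case by (simp add: sum.distrib[symmetric] distrib_right add.commute)
qed

lemma iter_part_sum:
  assumes V: "open V" and f: "\<And>i. i \<in> I \<Longrightarrow> smooth_on_open V (f i)" and "finite I"
  shows "x \<in> V \<Longrightarrow> iter_part \<beta> (\<lambda>z. \<Sum>i\<in>I. f i z) x = (\<Sum>i\<in>I. iter_part \<beta> (f i) x)"
proof (induction \<beta> arbitrary: x)
  case (Cons k \<beta>)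
  have "iter_part (k # \<beta>) (\<lambda>z. \<Sum>i\<in>I. f i z) x = dpart k (\<lambda>x. \<Sum>i\<in>I. iter_part \<beta> (f i) x) x"
    using dpart_cong_open[OF V Cons.prems Cons.IH] by simp
  also have "\<dots> = (\<Sum>i\<in>I. iter_part (k # \<beta>) (f i) x)"
    by (simp, intro dpart_sum assms smooth_on_openD[OF smooth_on_open_iter_part[OF f] Cons.prems])
  finally show ?case .
qed simp

text \<open>The operator \<open>T\<^sub>x\<close>. The coefficients \<open>tcoef G \<alpha>\<close> express \<open>\<partial>\<^sup>\<alpha> (T\<^sub>x f)\<close> at the point \<open>x\<close> itself in terms of
  the derivatives of \<open>f\<close> there, and \<open>acoef G i\<close> does the same for \<open>T\<^sub>x\<^sup>i f\<close>.\<close>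
definition hadamard_op :: "('n::finite \<Rightarrow> 'n \<Rightarrow> real^'n \<Rightarrow> real) \<Rightarrow> real^'n \<Rightarrow> (real^'n \<Rightarrow> real) \<Rightarrow> real^'n \<Rightarrow> real" where
  "hadamard_op G x f y = (\<Sum>j\<in>UNIV. \<Sum>k\<in>UNIV. dpart k (\<lambda>z. G k j z * segment_average x 0 (dpart j f) z) y)"

definition tcoef :: "('n::finite \<Rightarrow> 'n \<Rightarrow> real^'n \<Rightarrow> real) \<Rightarrow> 'n list \<Rightarrow> 'n list \<Rightarrow> real^'n \<Rightarrow> real" where
  "tcoef G \<alpha> js x = (if js = [] then 0 else
     (\<Sum>k\<in>UNIV. leibniz_coeff (G k (last js)) (\<alpha> @ [k]) (butlast js) x) / real (length js))"

fun acoef :: "('n::finite \<Rightarrow> 'n \<Rightarrow> real^'n \<Rightarrow> real) \<Rightarrow> nat \<Rightarrow> 'n list \<Rightarrow> real^'n \<Rightarrow> real" where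
  "acoef G 0 js = (\<lambda>x. if js = [] then 1 else 0)"
| "acoef G (Suc i) js = (\<lambda>x. \<Sum>\<beta> | length \<beta> \<le> 2 * i. acoef G i \<beta> x * tcoef G \<beta> js x)"

lemma tcoef_zero: "length js > length \<alpha> + 2 \<Longrightarrow> tcoef G \<alpha> js x = 0"
  by (simp add: tcoef_def leibniz_coeff_zero)

context
  fixes V :: "(real^'n::finite) set" and G :: "'n \<Rightarrow> 'n \<Rightarrow> real^'n \<Rightarrow> real"
  assumes oV: "open V" and G: "\<And>k j. smooth_on_open V (G k j)"
begin

lemma smooth_tcoef: "smooth_on_open V (tcoef G \<alpha> js)"
  unfolding tcoef_def[abs_def]
  by (cases "js = []") (auto intro!: smooth_on_open_divide smooth_on_open_sum smooth_on_open_const smooth_leibniz_coeff oV G)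

lemma smooth_acoef: "smooth_on_open V (acoef G i js)"
proof (induction i arbitrary: js)
  case 0
  show ?case by (auto intro: smooth_on_open_const oV)
next
  case (Suc i)
  show ?case by (auto intro!: smooth_on_open_sum smooth_on_open_mult smooth_tcoef Suc oV)
qed

context
  fixes x assumes cV: "convex V" and x: "x \<in> V"
begin

lemma smooth_hadamard_op_summand:
  assumes "smooth_on_open V f"
  shows "smooth_on_open V (\<lambda>z. G k j z * segment_average x 0 (dpart j f) z)"
  by (intro smooth_on_open_mult G smooth_segment_average smooth_on_open_dpart assms cV x)

lemma smooth_hadamard_op: "smooth_on_open V f \<Longrightarrow> smooth_on_open V (hadamard_op G x f)"
  unfolding hadamard_op_def[abs_def] by (intro smooth_on_open_sum smooth_on_open_dpart smooth_hadamard_op_summand oV)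

lemma smooth_hadamard_op_pow: "smooth_on_open V f \<Longrightarrow> smooth_on_open V ((hadamard_op G x ^^ i) f)"
  by (induction i) (auto intro: smooth_hadamard_op)

text \<open>Leibniz' rule together with \<open>segment_average_self\<close>. A list
  \<open>js = \<gamma> @ [j]\<close> records the Hadamard index \<open>j\<close> last and the
  derivatives \<open>\<gamma>\<close> on the average before it, and
  \<open>length \<gamma> + 1\<close> is the divisor. Evaluating at the base point is essential:
  elsewhere the averages are not local in f.\<close>

lemma iter_part_hadamard_op:
  assumes f: "smooth_on_open V f"
  shows "iter_part \<alpha> (hadamard_op G x f) x = (\<Sum>js | length js \<le> length \<alpha> + 2. tcoef G \<alpha> js x * iter_part js f x)"
proof -
  have "iter_part \<alpha> (hadamard_op G x f) x = (\<Sum>j\<in>UNIV. \<Sum>k\<in>UNIV. iter_part \<alpha> (dpart k (\<lambda>z. G k j z * segment_average x 0 (dpart j f) z)) x)"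
    unfolding hadamard_op_def[abs_def]
    by (subst iter_part_sum[OF oV _ _ x] ; (intro smooth_on_open_sum smooth_on_open_dpart smooth_hadamard_op_summand oV f finite)?)+
      (simp add: iter_part_sum[OF oV _ _ x] smooth_on_open_dpart smooth_hadamard_op_summand f)
  also have "\<dots> = (\<Sum>j\<in>UNIV. \<Sum>k\<in>UNIV. \<Sum>\<gamma> | length \<gamma> \<le> length \<alpha> + 1.
      leibniz_coeff (G k j) (\<alpha> @ [k]) \<gamma> x * iter_part (\<gamma> @ [j]) f x / (real (length \<gamma>) + 1))"
  proof (intro sum.cong refl)
    fix j k
    have "iter_part \<alpha> (dpart k (\<lambda>z. G k j z * segment_average x 0 (dpart j f) z)) x =
        iter_part (\<alpha> @ [k]) (\<lambda>z. G k j z * segment_average x 0 (dpart j f) z) x"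
      by (simp add: iter_part_append)
    also have "\<dots> = (\<Sum>\<gamma> | length \<gamma> \<le> length \<alpha> + 1. leibniz_coeff (G k j) (\<alpha> @ [k]) \<gamma> x * iter_part \<gamma> (segment_average x 0 (dpart j f)) x)"
      by (subst iter_part_mult[OF G smooth_segment_average[OF smooth_on_open_dpart[OF f] cV x] x]) simp
    also have "\<dots> = (\<Sum>\<gamma> | length \<gamma> \<le> length \<alpha> + 1. leibniz_coeff (G k j) (\<alpha> @ [k]) \<gamma> x * iter_part (\<gamma> @ [j]) f x / (real (length \<gamma>) + 1))"
      by (simp add: iter_part_segment_average[OF smooth_on_open_dpart[OF f] cV x x] segment_average_self iter_part_append)
    finally show "iter_part \<alpha> (dpart k (\<lambda>z. G k j z * segment_average x 0 (dpart j f) z)) x = \<dots>" .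
  qed
  also have "\<dots> = (\<Sum>j\<in>UNIV. \<Sum>\<gamma> | length \<gamma> \<le> length \<alpha> + 1. tcoef G \<alpha> (\<gamma> @ [j]) x * iter_part (\<gamma> @ [j]) f x)"
  proof (intro sum.cong refl)
    fix j
    show "(\<Sum>k\<in>UNIV. \<Sum>\<gamma> | length \<gamma> \<le> length \<alpha> + 1. leibniz_coeff (G k j) (\<alpha> @ [k]) \<gamma> x * iter_part (\<gamma> @ [j]) f x / (real (length \<gamma>) + 1))
      = (\<Sum>\<gamma> | length \<gamma> \<le> length \<alpha> + 1. tcoef G \<alpha> (\<gamma> @ [j]) x * iter_part (\<gamma> @ [j]) f x)"
      by (subst sum.swap) (simp add: tcoef_def sum_divide_distrib sum_distrib_right add.commute)
  qed
  finally show ?thesis using sum_lists_length_Suc_le[of "\<lambda>js. tcoef G \<alpha> js x * iter_part js f x" "length \<alpha> + 1"]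
    by (simp add: tcoef_def)
qed

text \<open>The first application of the operator is split off, so the induction hypothesis is used
  for \<open>hadamard_op G x f\<close> at the same base point; hence \<open>f\<close> is generalised
  while \<open>x\<close> stays fixed.\<close>

lemma hadamard_op_pow_eq_dop:
  "smooth_on_open V f \<Longrightarrow> (hadamard_op G x ^^ i) f x = dop (2 * i) (acoef G i) f x"
proof (induction i arbitrary: f)
  case 0
  have "{js :: 'n list. length js \<le> 2 * 0} = {[]}" by auto
  then show ?case by (simp add: dop_def)
next
  case (Suc i)
  have "(hadamard_op G x ^^ Suc i) f x = dop (2 * i) (acoef G i) (hadamard_op G x f) x"
    using Suc.IH[OF smooth_hadamard_op[OF Suc.prems]] by (simp only: funpow_Suc_right o_apply)
  also have "\<dots> = (\<Sum>\<beta> | length \<beta> \<le> 2 * i. acoef G i \<beta> x * (\<Sum>js | length js \<le> 2 * Suc i. tcoef G \<beta> js x * iter_part js f x))"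
    unfolding dop_def iter_part_hadamard_op[OF Suc.prems]
    by (intro sum.cong refl arg_cong2[where f = "(*)"] sum.mono_neutral_left finite_lists_le) (auto simp: tcoef_zero not_le)
  also have "\<dots> = (\<Sum>js | length js \<le> 2 * Suc i. \<Sum>\<beta> | length \<beta> \<le> 2 * i. acoef G i \<beta> x * tcoef G \<beta> js x * iter_part js f x)"
    unfolding sum_distrib_left by (subst sum.swap) (simp add: mult.assoc)
  finally show ?case by (simp add: dop_def sum_distrib_right)
qed

end
end

text \<open>At top order all derivatives miss G, so a step multiplies the symbol by the quadratic
  form of \<open>G\<close>. The divisor is the list length \<open>2 * i + 2\<close>; these divisors
  accumulate to 2^i i!.\<close>

lemma psym_acoef_Suc:
  "psym (2 * Suc i) (acoef G (Suc i)) x \<xi> =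
    (\<Sum>j\<in>UNIV. \<Sum>k\<in>UNIV. G k j x * \<xi> $ k * \<xi> $ j) / (2 * real i + 2) * psym (2 * i) (acoef G i) x \<xi>"
proof -
  define m where "m = (\<lambda>js. prod_list (map (\<lambda>j. \<xi> $ j) js))"
  define q where "q = (\<Sum>j\<in>UNIV. \<Sum>k\<in>UNIV. G k j x * \<xi> $ k * \<xi> $ j)"
  have top: "(\<Sum>js | length js = 2 * Suc i. tcoef G \<beta> js x * m js) = q / (2 * real i + 2) * m \<beta>"
    if \<beta>: "length \<beta> = 2 * i" for \<beta>
  proof -
    have "(\<Sum>js | length js = Suc (2 * i + 1). tcoef G \<beta> js x * m js) =
        (\<Sum>j\<in>UNIV. \<Sum>\<gamma> | length \<gamma> = 2 * i + 1. tcoef G \<beta> (\<gamma> @ [j]) x * m (\<gamma> @ [j]))"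
      by (rule sum_lists_length_Suc_eq)
    also have "\<dots> = (\<Sum>j\<in>UNIV. \<Sum>\<gamma> | length \<gamma> = 2 * i + 1. \<Sum>k\<in>UNIV.
        if \<gamma> = \<beta> @ [k] then G k j x * \<xi> $ k * \<xi> $ j / (2 * real i + 2) * m \<beta> else 0)"
    proof (intro sum.cong refl)
      fix j \<gamma> assume "\<gamma> \<in> {\<gamma> :: 'a list. length \<gamma> = 2 * i + 1}"
      then have "tcoef G \<beta> (\<gamma> @ [j]) x * m (\<gamma> @ [j]) =
          (\<Sum>k\<in>UNIV. if \<gamma> = \<beta> @ [k] then G k j x else 0) / (2 * real i + 2) * (m \<gamma> * \<xi> $ j)"
        using \<beta> by (simp add: tcoef_def leibniz_coeff_top m_def add.commute)
      also have "\<dots> = (\<Sum>k\<in>UNIV. if \<gamma> = \<beta> @ [k] then G k j x * \<xi> $ k * \<xi> $ j / (2 * real i + 2) * m \<beta> else 0)"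
        unfolding sum_divide_distrib sum_distrib_right by (intro sum.cong) (auto simp: m_def)
      finally show "tcoef G \<beta> (\<gamma> @ [j]) x * m (\<gamma> @ [j]) = \<dots>" .
    qed
    also have "\<dots> = (\<Sum>j\<in>UNIV. \<Sum>k\<in>UNIV. G k j x * \<xi> $ k * \<xi> $ j / (2 * real i + 2) * m \<beta>)"
      using \<beta> by (subst sum.swap) (simp add: finite_lists_eq)
    also have "\<dots> = q / (2 * real i + 2) * m \<beta>"
      by (simp add: q_def sum_distrib_right sum_divide_distrib)
    finally show ?thesis by simp
  qed
  have "psym (2 * Suc i) (acoef G (Suc i)) x \<xi> =
      (\<Sum>\<beta> | length \<beta> \<le> 2 * i. acoef G i \<beta> x * (\<Sum>js | length js = 2 * Suc i. tcoef G \<beta> js x * m js))"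
    unfolding psym_def acoef.simps sum_distrib_left sum_distrib_right
    by (subst sum.swap) (simp add: mult.assoc m_def)
  \<comment> \<open>One application adds at most two derivatives, so shorter \<open>\<beta>\<close>
    cannot reach length \<open>2 * Suc i\<close>.\<close>
  also have "\<dots> = (\<Sum>\<beta> | length \<beta> = 2 * i. acoef G i \<beta> x * (\<Sum>js | length js = 2 * Suc i. tcoef G \<beta> js x * m js))"
    by (rule sum.mono_neutral_right) (auto simp: finite_lists_le tcoef_zero)
  also have "\<dots> = (\<Sum>\<beta> | length \<beta> = 2 * i. q / (2 * real i + 2) * (acoef G i \<beta> x * m \<beta>))"
    by (intro sum.cong refl, subst top) auto
  finally show ?thesis by (simp add: psym_def m_def q_def sum_distrib_left)
qed


section \<open>Nonvanishing symbols, the exact expansion and its remainder\<close>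

lemma set_integrable_sum:
  fixes f :: "_ \<Rightarrow> _ \<Rightarrow> real"
  assumes "\<And>i. i \<in> I \<Longrightarrow> set_integrable M A (f i)"
  shows "set_integrable M A (\<lambda>x. \<Sum>i\<in>I. f i x)"
  using assms unfolding set_integrable_def scaleR_sum_right by (rule Bochner_Integration.integrable_sum)

lemma set_integral_sum:
  fixes f :: "_ \<Rightarrow> _ \<Rightarrow> real"
  assumes "\<And>i. i \<in> I \<Longrightarrow> set_integrable M A (f i)"
  shows "(LINT x:A|M. (\<Sum>i\<in>I. f i x)) = (\<Sum>i\<in>I. LINT x:A|M. f i x)"
  using assms unfolding set_integrable_def set_lebesgue_integral_def scaleR_sum_right
  by (rule Bochner_Integration.integral_sum)

context delzant_frame
begin

lemma frame_subset:
  assumes "open V'" "\<Delta> \<subseteq> V'" "V' \<subseteq> V"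
  shows "delzant_frame d u c V' G W"
proof
  show "smooth_on_open V' (G k j)" for k j using smooth_on_open_subset[OF smooth_G assms(1,3)] .
  show "smooth_on_open V' (W i j)" if "i < d" for i j using smooth_on_open_subset[OF smooth_W[OF that] assms(1,3)] .
qed (use assms compact interior primitive u_G u_W in auto)

lemma ex_lat_pos: "\<exists>x\<in>\<Delta>. \<forall>i<d. 0 < lat i x"
proof (rule ccontr)
  assume "\<not> ?thesis"
  moreover have "AE y in lborel. y \<in> \<Delta> \<longrightarrow> (\<forall>i<d. 0 < lat i y)"
    by (rule AE_lat_dist_pos) (use primitive in auto)
  ultimately have "AE y in lborel. y \<notin> \<Delta>" by (auto elim!: eventually_mono)
  then show False using not_AE_outside by blast
qed

text \<open>For a coordinate covector the quadratic form is \<open>G l l x\<close>. Inserting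
  \<open>u_W\<close> and then \<open>u_G\<close> rewrites it as the sum of
  \<open>lat i x * (W i l x)\<^sup>2\<close>, which is positive because \<open>u_W\<close> forbids
  all \<open>W i l x\<close> to vanish.\<close>

lemma psym_acoef_nonzero:
  assumes x: "x \<in> \<Delta>" and pos: "\<And>i. i < d \<Longrightarrow> 0 < lat i x"
  shows "psym (2 * i) (acoef G i) x (axis l 1) \<noteq> 0"
proof -
  have xV: "x \<in> V" using x V by blast
  have "(\<Sum>j\<in>UNIV. \<Sum>k\<in>UNIV. G k j x * axis l 1 $ k * axis l 1 $ j) = G l l x"
  proof -
    have "(\<Sum>k\<in>UNIV. G k j x * axis l 1 $ k * axis l 1 $ j) = (if j = l then G l l x else 0)" for j
      by (cases "j = l") (simp_all add: axis_def if_distrib[of "\<lambda>z. _ * z"] cong: if_cong)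
    then show ?thesis by simp
  qed
  moreover have "G l l x = (\<Sum>k\<in>UNIV. (if k = l then 1 else 0) * G k l x)"
    by (simp add: if_distrib[of "\<lambda>z. z * _"] cong: if_cong)
  moreover have "\<dots> = (\<Sum>k\<in>UNIV. (\<Sum>i<d. of_int (u i $ k) * W i l x) * G k l x)"
    by (simp only: u_W[OF xV])
  moreover have "\<dots> = (\<Sum>i<d. W i l x * (\<Sum>k\<in>UNIV. of_int (u i $ k) * G k l x))"
    unfolding sum_distrib_left sum_distrib_right by (subst sum.swap) (simp add: mult_ac)
  moreover have "\<dots> = (\<Sum>i<d. lat i x * (W i l x)\<^sup>2)"
    by (intro sum.cong refl, subst u_G[OF _ xV]) (auto simp: power2_eq_square)
  moreover have "0 < (\<Sum>i<d. lat i x * (W i l x)\<^sup>2)"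
  proof -
    have "\<exists>i<d. W i l x \<noteq> 0"
    proof (rule ccontr)
      assume "\<not> ?thesis"
      then have "(\<Sum>i<d. of_int (u i $ l) * W i l x) = 0" by (intro sum.neutral) auto
      then show False using u_W[OF xV, of l l] by simp
    qed
    then show ?thesis using pos by (force intro: sum_pos2[of "{..<d}"] simp: less_imp_le)
  qed
  ultimately have q: "(\<Sum>j\<in>UNIV. \<Sum>k\<in>UNIV. G k j x * axis l 1 $ k * axis l 1 $ j) \<noteq> 0" by simp
  show ?thesis
  proof (induction i)
    case 0
    then show ?case by (simp add: psym_def)
  next
    case (Suc i)
    then show ?case using q unfolding psym_acoef_Suc by simp
  qed
qed

lemma integrable_EN:
  assumes "x \<in> \<Delta>" "continuous_on \<Delta> h"
  shows "set_integrable lborel \<Delta> (\<lambda>y. EN d u c N x y * h y)"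
  unfolding set_integrable_def
  by (intro borel_integrable_compact compact continuous_intros continuous_on_EN assms)

lemma KN_integral: "(LINT y:\<Delta>|lborel. KN d u c N x y * h y) = (LINT y:\<Delta>|lborel. EN d u c N x y * h y) / cN d u c N x"
proof -
  have "(LINT y:\<Delta>|lborel. KN d u c N x y * h y) = (LINT y:\<Delta>|lborel. (EN d u c N x y * h y) / cN d u c N x)"
    by (simp add: KN_def)
  then show ?thesis by (simp only: set_integral_divide_zero)
qed

lemma smooth_continuous: "smooth_on_open V h \<Longrightarrow> continuous_on \<Delta> h"
  using V smooth_on_open_continuous_on continuous_on_subset by blast

lemma EN_integral_step:
  assumes x: "x \<in> \<Delta>" and N: "N > 0" and cV: "convex V" and f: "smooth_on_open V f"
  shows "(LINT y:\<Delta>|lborel. EN d u c N x y * f y) =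
    f x * cN d u c N x + (LINT y:\<Delta>|lborel. EN d u c N x y * hadamard_op G x f y) / real N"
proof -
  define s where "s = (\<lambda>j. segment_average x 0 (dpart j f))"
  have xV: "x \<in> V" using x V by blast
  have s: "smooth_on_open V (s j)" for j
    unfolding s_def by (intro smooth_segment_average smooth_on_open_dpart f cV xV)
  have cs: "continuous_on \<Delta> (\<lambda>y. (y $ j - x $ j) * s j y)" for j
    by (intro continuous_intros smooth_continuous s)
  have cD: "continuous_on \<Delta> (\<lambda>y. \<Sum>k\<in>UNIV. dpart k (\<lambda>z. G k j z * s j z) y)" for j
    by (intro smooth_continuous smooth_on_open_sum V smooth_on_open_dpart smooth_on_open_mult smooth_G s)
  have "(LINT y:\<Delta>|lborel. EN d u c N x y * f y) =
      (LINT y:\<Delta>|lborel. f x * EN d u c N x y + (\<Sum>j\<in>UNIV. EN d u c N x y * ((y $ j - x $ j) * s j y)))"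
  proof (rule set_lebesgue_integral_cong)
    show "\<Delta> \<in> sets lborel" using compact by (simp add: borel_compact)
    show "\<forall>y. y \<in> \<Delta> \<longrightarrow> EN d u c N x y * f y = f x * EN d u c N x y + (\<Sum>j\<in>UNIV. EN d u c N x y * ((y $ j - x $ j) * s j y))"
      using hadamard_expansion[OF f cV xV] V
      by (auto simp: s_def sum_distrib_left[symmetric] distrib_left mult.commute)
  qed
  also have "\<dots> = f x * cN d u c N x + (\<Sum>j\<in>UNIV. LINT y:\<Delta>|lborel. EN d u c N x y * ((y $ j - x $ j) * s j y))"
  proof (subst set_integral_add(2))
    show "set_integrable lborel \<Delta> (\<lambda>y. f x * EN d u c N x y)"
      using integrable_EN[OF x continuous_on_const, of N "f x"] by (simp add: mult.commute)
    show "set_integrable lborel \<Delta> (\<lambda>y. \<Sum>j\<in>UNIV. EN d u c N x y * ((y $ j - x $ j) * s j y))"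
      by (rule set_integrable_sum) (auto intro: integrable_EN x cs)
    show "(LINT y:\<Delta>|lborel. f x * EN d u c N x y) + (LINT y:\<Delta>|lborel. \<Sum>j\<in>UNIV. EN d u c N x y * ((y $ j - x $ j) * s j y))
        = f x * cN d u c N x + (\<Sum>j\<in>UNIV. LINT y:\<Delta>|lborel. EN d u c N x y * ((y $ j - x $ j) * s j y))"
      using integrable_EN[OF x cs] by (subst set_integral_sum) (auto simp: cN_def)
  qed
  also have "(\<Sum>j\<in>UNIV. LINT y:\<Delta>|lborel. EN d u c N x y * ((y $ j - x $ j) * s j y)) =
      (\<Sum>j\<in>UNIV. (LINT y:\<Delta>|lborel. EN d u c N x y * (\<Sum>k\<in>UNIV. dpart k (\<lambda>z. G k j z * s j z) y)) / real N)"
  proof (intro sum.cong refl)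
    fix j
    have "real N * (LINT y:\<Delta>|lborel. EN d u c N x y * ((y $ j - x $ j) * s j y)) =
        (LINT y:\<Delta>|lborel. EN d u c N x y * (real N * (y $ j - x $ j) * s j y))"
      by (subst set_integral_mult_right[symmetric]) (simp add: mult_ac)
    then show "(LINT y:\<Delta>|lborel. EN d u c N x y * ((y $ j - x $ j) * s j y)) =
        (LINT y:\<Delta>|lborel. EN d u c N x y * (\<Sum>k\<in>UNIV. dpart k (\<lambda>z. G k j z * s j z) y)) / real N"
      using integration_by_parts[OF x s, of N j j] N by (simp add: field_simps)
  qed
  also have "\<dots> = (LINT y:\<Delta>|lborel. \<Sum>j\<in>UNIV. EN d u c N x y * (\<Sum>k\<in>UNIV. dpart k (\<lambda>z. G k j z * s j z) y)) / real N"
    using integrable_EN[OF x cD] by (subst set_integral_sum) (auto simp: sum_divide_distrib)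
  finally show ?thesis by (simp add: hadamard_op_def s_def sum_distrib_left)
qed

text \<open>Exact for every \<open>N > 0\<close>: the whole asymptotic content sits in the last
  integral.\<close>

lemma KN_integral_expansion:
  assumes x: "x \<in> \<Delta>" and N: "N > 0" and cV: "convex V" and f: "smooth_on_open V f"
  shows "(LINT y:\<Delta>|lborel. KN d u c N x y * f y) =
    (\<Sum>i<m. (hadamard_op G x ^^ i) f x / real N ^ i) + (LINT y:\<Delta>|lborel. KN d u c N x y * (hadamard_op G x ^^ m) f y) / real N ^ m"
proof (induction m)
  case (Suc m)
  have xV: "x \<in> V" using x V by blast
  have sm: "smooth_on_open V ((hadamard_op G x ^^ m) f)" by (rule smooth_hadamard_op_pow[OF V(1) smooth_G cV xV f])
  have "(LINT y:\<Delta>|lborel. KN d u c N x y * (hadamard_op G x ^^ m) f y) =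
      (hadamard_op G x ^^ m) f x + (LINT y:\<Delta>|lborel. KN d u c N x y * (hadamard_op G x ^^ Suc m) f y) / real N"
    unfolding KN_integral EN_integral_step[OF x N cV sm] using cN_pos[OF x, of N] by (simp add: add_divide_distrib)
  then show ?case using Suc N by (simp add: field_simps)
qed simp

text \<open>The kernel is nonnegative with total mass 1, so the supremum of the integrand's other
  factor bounds the integral for every \<open>N\<close>.\<close>

lemma KN_integral_bounded:
  assumes x: "x \<in> \<Delta>" and h: "continuous_on \<Delta> h"
  obtains B where "\<And>N. \<bar>LINT y:\<Delta>|lborel. KN d u c N x y * h y\<bar> \<le> B"
proof -
  obtain B where B: "\<And>y. y \<in> \<Delta> \<Longrightarrow> \<bar>h y\<bar> \<le> B"
    using compact_imp_bounded[OF compact_continuous_image[OF h compact]] unfolding bounded_iff by auto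
  have "\<bar>LINT y:\<Delta>|lborel. KN d u c N x y * h y\<bar> \<le> B" for N
  proof -
    have "\<bar>LINT y:\<Delta>|lborel. EN d u c N x y * h y\<bar> \<le> (\<integral>y. \<bar>indicator \<Delta> y *\<^sub>R (EN d u c N x y * h y)\<bar> \<partial>lborel)"
      unfolding set_lebesgue_integral_def by (rule integral_abs_bound)
    also have "\<dots> \<le> (\<integral>y. indicator \<Delta> y *\<^sub>R (EN d u c N x y * B) \<partial>lborel)"
    proof (rule integral_mono)
      show "integrable lborel (\<lambda>y. \<bar>indicator \<Delta> y *\<^sub>R (EN d u c N x y * h y)\<bar>)"
        using integrable_EN[OF x h, of N] unfolding set_integrable_def by (rule integrable_abs)
      show "integrable lborel (\<lambda>y. indicator \<Delta> y *\<^sub>R (EN d u c N x y * B))"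
        using integrable_EN[OF x continuous_on_const, of N B] unfolding set_integrable_def .
      show "\<bar>indicator \<Delta> y *\<^sub>R (EN d u c N x y * h y)\<bar> \<le> indicator \<Delta> y *\<^sub>R (EN d u c N x y * B)" for y
        using B[of y] EN_nonneg[of N x y] by (cases "y \<in> \<Delta>") (auto simp: abs_mult intro!: mult_left_mono)
    qed
    also have "\<dots> = B * cN d u c N x"
      unfolding cN_def set_lebesgue_integral_def by (simp flip: mult.assoc)
    finally show ?thesis unfolding KN_integral using cN_pos[OF x, of N] by (simp add: abs_divide field_simps)
  qed
  then show ?thesis using that by blast
qed

end

lemma delzant_obtains_frame:
  fixes u :: "nat \<Rightarrow> int^'n::finite"
  assumes "delzant d u c"
  obtains V G W where "delzant_frame d u c V G W"
proof (rule smooth_saddle_point[of d u c])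
  fix g :: "'n \<Rightarrow> real" and j
  assume "\<And>i. i < d \<Longrightarrow> (\<Sum>j\<in>UNIV. of_int (u i $ j) * g j) = 0"
  then show "g j = 0" by (rule delzant_full[OF assms])
next
  fix y w i
  assume "y \<in> poly_set d u c" "\<And>i. i < d \<Longrightarrow> lat_dist u c i y \<noteq> 0 \<Longrightarrow> w i = 0"
    "\<And>j. (\<Sum>i<d. of_int (u i $ j) * w i) = (0::real)" "i < d"
  then show "w i = 0" by (rule delzant_indep[OF assms])
next
  fix V :: "(real^'n) set" and G W
  assume *: "open V" "poly_set d u c \<subseteq> V"
    "\<And>k j. smooth_on_open V (G k j)" "\<And>i j. i < d \<Longrightarrow> smooth_on_open V (W i j)"
    "\<And>i j y. i < d \<Longrightarrow> y \<in> V \<Longrightarrow> (\<Sum>k\<in>UNIV. of_int (u i $ k) * G k j y) = lat_dist u c i y * W i j y"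
    "\<And>k j y. y \<in> V \<Longrightarrow> (\<Sum>i<d. of_int (u i $ k) * W i j y) = (if k = j then 1 else 0)"
  have D: "compact (poly_set d u c)" "interior (poly_set d u c) \<noteq> {}" "\<And>i. i < d \<Longrightarrow> primitive_vec (u i)"
    using assms unfolding delzant_def by blast+
  have "delzant_frame d u c V G W" by (intro delzant_frame.intro D *)
  then show thesis by (rule that)
qed

text \<open>A thickening of \<open>S\<close> by a small ball is a Minkowski sum of two convex
  sets.\<close>

lemma convex_open_neighbourhood:
  fixes S U :: "'a::real_normed_vector set"
  assumes "compact S" "convex S" "open U" "S \<subseteq> U"
  obtains V where "open V" "convex V" "S \<subseteq> V" "V \<subseteq> U"
proof -
  obtain e where e: "e > 0" "(\<Union>x\<in>S. ball x e) \<subseteq> U"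
    using compact_subset_open_imp_ball_epsilon_subset[OF assms(1,3,4)] by blast
  have eq: "(\<Union>x\<in>S. ball x e) = (\<Union>x\<in>S. \<Union>y\<in>ball 0 e. {x + y})"
  proof -
    have "ball x e = (\<Union>y\<in>ball 0 e. {x + y})" for x :: 'a
      by (auto simp: dist_norm image_iff norm_minus_commute intro!: bexI[of _ "_ - x"])
    then show ?thesis by (rule SUP_cong[OF refl])
  qed
  have "convex (\<Union>x\<in>S. ball x e)" unfolding eq by (rule convex_sums[OF assms(2) convex_ball])
  then show ?thesis using e by (intro that[of "\<Union>x\<in>S. ball x e"]) auto
qed

theorem theorem1p1:
  fixes d :: nat and u :: "nat \<Rightarrow> int^'n::finite" and c :: "nat \<Rightarrow> int"
  assumes "delzant d u c"
  shows "\<exists>a :: nat \<Rightarrow> 'n list \<Rightarrow> real^'n \<Rightarrow> real.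
     (\<forall>i js. smooth_on_set (poly_set d u c) (a i js)) \<and>
     (\<forall>x\<in>poly_set d u c. a 0 [] x = 1) \<and>
     (\<forall>i\<ge>1. \<exists>x\<in>poly_set d u c. \<exists>\<xi>. psym (2 * i) (a i) x \<xi> \<noteq> 0) \<and>
     (\<forall>U g. poly_set d u c \<subseteq> U \<and> smooth_on_open U g \<longrightarrow>
        (\<forall>x\<in>poly_set d u c. \<forall>m\<ge>1.
           (\<lambda>N::nat. (LINT y:poly_set d u c|lborel. KN d u c N x y * g y)
                      - (\<Sum>i<m. dop (2 * i) (a i) g x / real N ^ i))
           \<in> O(\<lambda>N. 1 / real N ^ m)))"
proof -
  obtain V G W where "delzant_frame d u c V G W" using delzant_obtains_frame[OF assms] .
  then interpret F: delzant_frame d u c V G W .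
  show ?thesis
  proof (intro exI[of _ "acoef G"] conjI allI impI ballI)
    show "smooth_on_set (poly_set d u c) (acoef G i js)" for i js
      unfolding smooth_on_set_def
      by (intro exI[of _ V] exI[of _ "acoef G i js"] conjI F.V smooth_acoef F.smooth_G) simp
    show "acoef G 0 [] x = 1" for x by simp
    \<comment> \<open>The witness is a point off all facets with a coordinate covector.\<close>
    show "\<exists>x\<in>poly_set d u c. \<exists>\<xi>. psym (2 * i) (acoef G i) x \<xi> \<noteq> 0" for i
      using F.ex_lat_pos F.psym_acoef_nonzero by blast
    fix U g x and m :: nat
    assume Ug: "poly_set d u c \<subseteq> U \<and> smooth_on_open U g" and x: "x \<in> poly_set d u c"
    have oU: "open U" using Ug smooth_on_open_def by blast
    \<comment> \<open>Hadamard's lemma needs a convex domain on which both \<open>g\<close> and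
      \<open>G\<close> are smooth. Shrinking to \<open>V'\<close> leaves the coefficients alone,
      since \<open>acoef G\<close> is built from \<open>G\<close> and its derivatives at
      \<open>x\<close>; so they do not depend on \<open>g\<close>.\<close>
    obtain V' where V': "open V'" "convex V'" "poly_set d u c \<subseteq> V'" "V' \<subseteq> U \<inter> V"
      by (rule convex_open_neighbourhood[OF F.compact convex_poly_set, of "U \<inter> V"])
        (use oU F.V Ug in auto)
    interpret F': delzant_frame d u c V' G W by (rule F.frame_subset) (use V' in auto)
    have g: "smooth_on_open V' g" using Ug V' smooth_on_open_subset by blast
    have xV: "x \<in> V'" using x V' by blast
    have cont: "continuous_on (poly_set d u c) ((hadamard_op G x ^^ m) g)"
      by (rule F'.smooth_continuous[OF smooth_hadamard_op_pow[OF V'(1) F'.smooth_G V'(2) xV g]])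
    obtain B where B: "\<And>N. \<bar>LINT y:poly_set d u c|lborel. KN d u c N x y * (hadamard_op G x ^^ m) g y\<bar> \<le> B"
      by (rule F'.KN_integral_bounded[OF x cont]) (rule that)
    show "(\<lambda>N::nat. (LINT y:poly_set d u c|lborel. KN d u c N x y * g y)
        - (\<Sum>i<m. dop (2 * i) (acoef G i) g x / real N ^ i)) \<in> O(\<lambda>N. 1 / real N ^ m)"
    proof (rule bigoI[of _ B])
      show "\<forall>\<^sub>F N in sequentially. norm ((LINT y:poly_set d u c|lborel. KN d u c N x y * g y)
          - (\<Sum>i<m. dop (2 * i) (acoef G i) g x / real N ^ i)) \<le> B * norm (1 / real N ^ m)"
        using eventually_gt_at_top[of 0]
      proof eventually_elim
        case (elim N)
        have "(LINT y:poly_set d u c|lborel. KN d u c N x y * g y)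
            - (\<Sum>i<m. dop (2 * i) (acoef G i) g x / real N ^ i) =
            (LINT y:poly_set d u c|lborel. KN d u c N x y * (hadamard_op G x ^^ m) g y) / real N ^ m"
          using F'.KN_integral_expansion[OF x elim V'(2) g, of m]
          by (simp add: hadamard_op_pow_eq_dop[OF V'(1) F'.smooth_G V'(2) xV g])
        then show ?case using B[of N] by (simp add: abs_divide divide_right_mono)
      qed
    qed
  qed
qed

end
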